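(* Let $0<\lambda<\Lambda$ and $\mathcal{A}=\{a\in L_\infty(0,1) : \lambda\le a\le\Lambda\}$. Let $f\in L_1(0,1)$ with $f\neq 0$ a.e., and let $a\in\mathcal{A}$. If $\{a_n\}\subset\mathcal{A}$ is a sequence such that $u_{a_n}$ converges to $u_a$ in $H^1_0(0,1)$, then $a_n$ converges to $a$ in $L_p(0,1)$ for every $1\le p<\infty$. In particular, if $a,b\in\mathcal{A}$, then $u_a=u_b$ implies $a=b$ a.e.
   Context: For $a\in\mathcal{A}$, $u_a\in H^1_0(0,1)$ denotes the unique weak solution of $-(a u')'=f$ on $(0,1)$ with homogeneous Dirichlet boundary conditions, that is, $\int_0^1 a u_a' v'\,dx=\int_0^1 f v\,dx$ for all $v\in H^1_0(0,1)$. *)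

theory Defs
  imports "HOL-Analysis.Analysis"
begin

text \<open>
  Elements of the function spaces over $(0,1)$ are represented by functions
  \<^typ>\<open>real \<Rightarrow> real\<close> that are only relevant up to equality almost everywhere on $(0,1)$;
  equality of elements is therefore stated with \<open>AE\<close>.
\<close>

abbreviation I01 :: "real measure" where
  "I01 \<equiv> lebesgue_on {0<..<1}"


subsection \<open>Lebesgue spaces\<close>

definition Lp :: "real \<Rightarrow> (real \<Rightarrow> real) set" where
  "Lp p = {g \<in> borel_measurable I01. integrable I01 (\<lambda>x. \<bar>g x\<bar> powr p)}"

definition Lp_norm :: "real \<Rightarrow> (real \<Rightarrow> real) \<Rightarrow> real" where
  "Lp_norm p g = (LINT x|I01. \<bar>g x\<bar> powr p) powr (1 / p)"

definition Linf :: "(real \<Rightarrow> real) set" where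
  "Linf = {g \<in> borel_measurable I01. \<exists>C. AE x in I01. \<bar>g x\<bar> \<le> C}"

text \<open>
  Membership is part of convergence because the Bochner integral of a non-integrable function
  is \<open>0\<close>, so that a vanishing \<open>Lp_norm\<close> alone would carry no information.
\<close>

definition tendsto_Lp :: "real \<Rightarrow> (nat \<Rightarrow> real \<Rightarrow> real) \<Rightarrow> (real \<Rightarrow> real) \<Rightarrow> bool" where
  "tendsto_Lp p g h \<longleftrightarrow> (\<forall>n. g n \<in> Lp p) \<and> h \<in> Lp p \<and>
     (\<lambda>n. Lp_norm p (\<lambda>x. g n x - h x)) \<longlonglongrightarrow> 0"


subsection \<open>Sobolev spaces\<close>

text \<open>The space $C_c^\infty(0,1)$; its elements are extended by zero to the real line.\<close>

definition test_fun :: "(real \<Rightarrow> real) \<Rightarrow> bool" where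
  "test_fun \<phi> \<longleftrightarrow> (\<forall>k x. (deriv ^^ k) \<phi> field_differentiable at x) \<and>
     closure {x. \<phi> x \<noteq> 0} \<subseteq> {0<..<1}"

definition has_weak_deriv :: "(real \<Rightarrow> real) \<Rightarrow> (real \<Rightarrow> real) \<Rightarrow> bool" where
  "has_weak_deriv u g \<longleftrightarrow> u \<in> Lp 2 \<and> g \<in> Lp 2 \<and>
     (\<forall>\<phi>. test_fun \<phi> \<longrightarrow> (LINT x|I01. u x * deriv \<phi> x) = - (LINT x|I01. g x * \<phi> x))"

definition H1 :: "(real \<Rightarrow> real) set" where
  "H1 = {u. \<exists>g. has_weak_deriv u g}"

text \<open>The weak derivative is unique only up to null sets; this picks one representative.\<close>

definition weak_deriv :: "(real \<Rightarrow> real) \<Rightarrow> real \<Rightarrow> real" where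
  "weak_deriv u = (SOME g. has_weak_deriv u g)"

definition H1_norm :: "(real \<Rightarrow> real) \<Rightarrow> real" where
  "H1_norm u = sqrt ((Lp_norm 2 u)\<^sup>2 + (Lp_norm 2 (weak_deriv u))\<^sup>2)"

text \<open>$H^1_0(0,1)$ is the closure of $C_c^\infty(0,1)$ in $H^1(0,1)$.\<close>

definition H10 :: "(real \<Rightarrow> real) set" where
  "H10 = {u \<in> H1. \<exists>\<phi>. (\<forall>n. test_fun (\<phi> n)) \<and> (\<lambda>n. H1_norm (\<lambda>x. u x - \<phi> n x)) \<longlonglongrightarrow> 0}"

definition tendsto_H10 :: "(nat \<Rightarrow> real \<Rightarrow> real) \<Rightarrow> (real \<Rightarrow> real) \<Rightarrow> bool" where
  "tendsto_H10 v u \<longleftrightarrow> (\<forall>n. v n \<in> H10) \<and> u \<in> H10 \<and>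
     (\<lambda>n. H1_norm (\<lambda>x. v n x - u x)) \<longlonglongrightarrow> 0"


subsection \<open>The diffusion problem\<close>

definition admissible :: "real \<Rightarrow> real \<Rightarrow> (real \<Rightarrow> real) set" where
  "admissible l L = {a \<in> Linf. AE x in I01. l \<le> a x \<and> a x \<le> L}"

text \<open>
  \<open>weak_solution f a u\<close> says that \<open>u\<close> represents the solution $u_a$ of $-(a u')' = f$ with
  homogeneous Dirichlet boundary conditions.
\<close>

definition weak_solution :: "(real \<Rightarrow> real) \<Rightarrow> (real \<Rightarrow> real) \<Rightarrow> (real \<Rightarrow> real) \<Rightarrow> bool" where
  "weak_solution f a u \<longleftrightarrow> u \<in> H10 \<and>
     (\<forall>v\<in>H10. (LINT x|I01. a x * weak_deriv u x * weak_deriv v x) = (LINT x|I01. f x * v x))"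

end

theory Submission
  imports Defs "HOL-Computational_Algebra.Polynomial"
begin

text \<open>
  In one dimension the equation \<open>- (a u')' = f\<close> can be integrated once. With \<open>F\<close> the primitive of \<open>f\<close>
  that starts at \<open>0\<close>, a weak solution satisfies \<open>a u' = c - F\<close> almost everywhere for some constant \<open>c\<close>
  (\<open>weak_solution_flux\<close>). All coefficients share the same \<open>F\<close>, so for two of them, \<open>a\<close> and \<open>a\<^sub>n\<close>,
  subtraction gives
  \<open>(a\<^sub>n - a) u' = (c\<^sub>n - c) - a\<^sub>n (u\<^sub>n' - u')\<close>.
  If the solutions converge, the last term tends to \<open>0\<close> in \<open>L\<^sub>1\<close>. Two facts remain.

  The constants converge. Since \<open>u'\<close> has mean \<open>0\<close> and \<open>a > 0\<close>, the continuous function \<open>c - F\<close> has a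
  zero (\<open>flux_vanishes_somewhere\<close>). Near that zero \<open>u' = (c - F) / a\<close> is small, hence so is the left-hand
  side, whatever \<open>a\<^sub>n\<close> is; thus \<open>c\<^sub>n - c\<close>, which does not depend on the point, is small
  (\<open>constants_converge\<close>). Therefore \<open>(a\<^sub>n - a) u'\<close> tends to \<open>0\<close> in \<open>L\<^sub>1\<close>.

  The weight \<open>u'\<close> can be removed. Up to a null set it vanishes exactly where \<open>F = c\<close>, and there \<open>F' = f\<close> is \<open>0\<close> almost
  everywhere (\<open>zero_on_level_set_of_primitive\<close>). As \<open>f\<close> is nonzero almost everywhere, \<open>u'\<close> is too, and
  the uniformly bounded functions \<open>a\<^sub>n - a\<close> tend to \<open>0\<close> in \<open>L\<^sub>1\<close> (\<open>weighted_L1_convergence\<close>) and, by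
  interpolation with the bound, in every \<open>L\<^sub>p\<close> with finite \<open>p\<close>.

  The tools are the fundamental lemma of the calculus of variations and its consequence by du Bois-Reymond,
  together with a weak chain rule for primitives of integrable functions, all obtained from
  the density of continuous functions.
\<close>

section \<open>Smooth functions and cut-offs\<close>

text \<open>
  The iterated derivatives in the definition of test functions, as a property of its own that is
  closed under algebra.
\<close>

definition smooth :: "(real \<Rightarrow> real) \<Rightarrow> bool" where
  "smooth f \<longleftrightarrow> (\<forall>k x. (deriv ^^ k) f field_differentiable at x)"

lemma test_fun_iff: "test_fun \<phi> \<longleftrightarrow> smooth \<phi> \<and> closure {x. \<phi> x \<noteq> 0} \<subseteq> {0<..<1}"
  by (simp add: test_fun_def smooth_def)

text \<open>
  Smoothness is a greatest fixed point: a family of functions that contains a derivative of each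
  of its members consists of smooth functions. Every smoothness proof below exhibits such a family,
  so that no iterated derivative is ever computed.
\<close>

lemma smooth_coinduct:
  assumes "f \<in> S"
    and closed: "\<And>g. g \<in> S \<Longrightarrow> \<exists>g'\<in>S. \<forall>x. (g has_field_derivative g' x) (at x)"
  shows "smooth f"
proof -
  have step: "deriv g \<in> S" "g field_differentiable at x" if "g \<in> S" for g x
  proof -
    obtain g' where g': "g' \<in> S" "\<And>x. (g has_field_derivative g' x) (at x)"
      using closed[OF \<open>g \<in> S\<close>] by blast
    then have "deriv g = g'" by (auto intro!: DERIV_imp_deriv)
    then show "deriv g \<in> S" "g field_differentiable at x"
      using g' by (auto simp: field_differentiable_def)
  qed
  have "(deriv ^^ k) f \<in> S" for k
    by (induction k) (auto simp: step assms(1))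
  then show ?thesis by (auto simp: smooth_def step(2))
qed

lemma smooth_deriv: "smooth f \<Longrightarrow> smooth (deriv f)"
proof -
  assume f: "smooth f"
  have "(deriv ^^ k) (deriv f) = (deriv ^^ Suc k) f" for k
    by (simp only: funpow_Suc_right comp_apply)
  with f show ?thesis unfolding smooth_def by metis
qed

lemma smooth_has_deriv: "smooth f \<Longrightarrow> (f has_field_derivative deriv f x) (at x)"
  by (metis smooth_def funpow_0 field_differentiable_derivI)

lemma smooth_antideriv:
  assumes "\<And>x. (f has_field_derivative f' x) (at x)" "smooth f'"
  shows "smooth f"
  by (rule smooth_coinduct[of f "insert f (Collect smooth)"])
     (use assms in \<open>auto intro: smooth_deriv smooth_has_deriv\<close>)

lemma continuous_on_smooth: "smooth f \<Longrightarrow> continuous_on A f"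
  by (meson DERIV_continuous continuous_at_imp_continuous_on smooth_has_deriv)

lemma smooth_const: "smooth (\<lambda>x. c)"
  by (rule smooth_coinduct[of _ "range (\<lambda>c x. c)"]) (auto intro!: derivative_eq_intros)

lemma smooth_ident: "smooth (\<lambda>x. x)"
  by (rule smooth_antideriv[where f' = "\<lambda>x. 1"]) (auto simp: smooth_const intro!: derivative_eq_intros)

text \<open>
  The algebra generated by the smooth functions. By the sum and product rules it contains the
  derivatives of its members, hence it adds nothing, which is the closure of smoothness under sums
  and products.
\<close>

inductive_set smooth_alg :: "(real \<Rightarrow> real) set" where
  "smooth f \<Longrightarrow> f \<in> smooth_alg"
| "f \<in> smooth_alg \<Longrightarrow> g \<in> smooth_alg \<Longrightarrow> (\<lambda>x. f x + g x) \<in> smooth_alg"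
| "f \<in> smooth_alg \<Longrightarrow> g \<in> smooth_alg \<Longrightarrow> (\<lambda>x. f x * g x) \<in> smooth_alg"

lemma smooth_alg_smooth: "f \<in> smooth_alg \<Longrightarrow> smooth f"
proof (rule smooth_coinduct)
  fix g assume "g \<in> smooth_alg"
  then show "\<exists>g'\<in>smooth_alg. \<forall>x. (g has_field_derivative g' x) (at x)"
  proof induction
    case (1 f)
    then show ?case
      by (intro bexI[of _ "deriv f"]) (auto intro: smooth_alg.intros smooth_deriv smooth_has_deriv)
  next
    case (2 f g)
    then obtain f' g' where "f' \<in> smooth_alg" "g' \<in> smooth_alg"
      "\<And>x. (f has_field_derivative f' x) (at x)" "\<And>x. (g has_field_derivative g' x) (at x)" by blast
    then show ?case
      by (intro bexI[of _ "\<lambda>x. f' x + g' x"]) (auto intro: smooth_alg.intros intro!: derivative_intros)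
  next
    case (3 f g)
    then obtain f' g' where "f' \<in> smooth_alg" "g' \<in> smooth_alg"
      "\<And>x. (f has_field_derivative f' x) (at x)" "\<And>x. (g has_field_derivative g' x) (at x)" by blast
    with 3 show ?case
      by (intro bexI[of _ "\<lambda>x. f' x * g x + g' x * f x"])
        (auto intro: smooth_alg.intros intro!: DERIV_mult)
  qed
qed

lemma smooth_add: "smooth f \<Longrightarrow> smooth g \<Longrightarrow> smooth (\<lambda>x. f x + g x)"
  and smooth_mult: "smooth f \<Longrightarrow> smooth g \<Longrightarrow> smooth (\<lambda>x. f x * g x)"
  by (auto intro!: smooth_alg_smooth intro: smooth_alg.intros)

lemma smooth_diff: "smooth f \<Longrightarrow> smooth g \<Longrightarrow> smooth (\<lambda>x. f x - g x)"
  using smooth_add[of f "\<lambda>x. -1 * g x"] smooth_mult[OF smooth_const, of g "-1"] by simp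

lemma smooth_affine:
  assumes "smooth f"
  shows "smooth (\<lambda>x. f (p * x + q))"
proof (rule smooth_coinduct)
  show "(\<lambda>x. f (p * x + q)) \<in> {\<lambda>x. r * f (p * x + q) | r f. smooth f}"
    using assms by (auto intro!: exI[of _ 1])
next
  fix g assume "g \<in> {\<lambda>x. r * f (p * x + q) | r f. smooth f}"
  then obtain r f where g: "g = (\<lambda>x. r * f (p * x + q))" "smooth f" by auto
  have "(g has_field_derivative (r * p) * deriv f (p * x + q)) (at x)" for x
    unfolding g
    by (auto intro!: derivative_eq_intros DERIV_chain2[OF smooth_has_deriv[OF g(2)]])
  then show "\<exists>g'\<in>{\<lambda>x. r * f (p * x + q) | r f. smooth f}. \<forall>x. (g has_field_derivative g' x) (at x)"
    using smooth_deriv[OF g(2)]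
    by (intro bexI[of _ "\<lambda>x. (r * p) * deriv f (p * x + q)"]) auto
qed

lemma smooth_real_polynomial_function:
  "real_polynomial_function p \<Longrightarrow> smooth (p :: real \<Rightarrow> real)"
proof (induction rule: real_polynomial_function.induct)
  case (linear f)
  then obtain c where "f = (\<lambda>x. x * c)" using real_bounded_linear by auto
  then show ?case by (simp add: smooth_mult smooth_const smooth_ident)
qed (auto intro: smooth_const smooth_add smooth_mult)

text \<open>
  For \<open>P = 1\<close> this is the classical smooth function \<open>exp (- 1 / x)\<close> on the right half-line, extended
  by \<open>0\<close>. The polynomial factor in \<open>1 / x\<close> makes the family closed under differentiation.
\<close>

definition exp_step :: "real poly \<Rightarrow> real \<Rightarrow> real" where
  "exp_step P x = (if x > 0 then poly P (1 / x) * exp (- (1 / x)) else 0)"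

lemma poly_times_exp_minus_tendsto_0:
  "((\<lambda>y. poly P y * exp (- y)) \<longlongrightarrow> (0::real)) at_top"
proof -
  have "((\<lambda>y. \<Sum>i\<le>degree P. coeff P i * (y ^ i / exp y)) \<longlongrightarrow> (\<Sum>i\<le>degree P. coeff P i * 0)) at_top"
    by (intro tendsto_intros tendsto_power_div_exp_0)
  then show ?thesis
    by (simp add: poly_altdef exp_minus divide_inverse sum_distrib_right mult.assoc)
qed

text \<open>
  Away from \<open>0\<close> this is the chain rule. At \<open>0\<close> the difference quotient is again a polynomial in
  \<open>1 / x\<close> times \<open>exp (- 1 / x)\<close>, and the exponential wins.
\<close>

lemma exp_step_has_deriv:
  "(exp_step P has_field_derivative exp_step ([:0, 0, 1:] * (P - pderiv P)) x) (at x)"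
proof (cases x "0::real" rule: linorder_cases)
  case less
  have "((\<lambda>x. 0) has_field_derivative 0) (at x)" by simp
  then have "(exp_step P has_field_derivative 0) (at x)"
    by (rule has_field_derivative_transform_within_open[of _ _ _ "{..<0}"])
      (use less in \<open>auto simp: exp_step_def\<close>)
  then show ?thesis using less by (simp add: exp_step_def)
next
  case greater
  have "((\<lambda>x. poly P (1 / x) * exp (- (1 / x))) has_field_derivative
     exp_step ([:0, 0, 1:] * (P - pderiv P)) x) (at x)"
    using greater
    by (auto intro!: derivative_eq_intros DERIV_chain2[OF poly_DERIV] simp: exp_step_def field_simps power2_eq_square)
  then show ?thesis
    by (rule has_field_derivative_transform_within_open[of _ _ _ "{0<..}"])
      (use greater in \<open>auto simp: exp_step_def\<close>)
next
  case equal
  have "((\<lambda>y. exp_step P y / y) \<longlongrightarrow> 0) (at 0)"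
  proof (rule filterlim_split_at)
    show "((\<lambda>y. exp_step P y / y) \<longlongrightarrow> 0) (at_left 0)"
      by (rule tendsto_eventually) (auto simp: eventually_at_filter exp_step_def)
    have "((\<lambda>y. poly (pCons 0 P) (1 / y) * exp (- (1 / y))) \<longlongrightarrow> 0) (at_right 0)"
      using filterlim_compose[OF poly_times_exp_minus_tendsto_0[of "pCons 0 P"] filterlim_inverse_at_top_right]
      by (simp add: inverse_eq_divide)
    then show "((\<lambda>y. exp_step P y / y) \<longlongrightarrow> 0) (at_right 0)"
      by (rule Lim_transform_eventually) (auto simp: eventually_at_filter exp_step_def)
  qed
  then show ?thesis using equal by (simp add: has_field_derivative_iff exp_step_def)
qed

lemma smooth_exp_step: "smooth (exp_step P)"
  by (rule smooth_coinduct[of _ "range exp_step"]) (auto intro: exp_step_has_deriv)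

text \<open>
  Scaling the argument of a step by \<open>n\<close> sharpens it, so that these functions tend to \<open>1\<close> inside
  the interval. The offset \<open>1 / (n + 3)\<close> keeps the support away from the end points \<open>0\<close> and \<open>1\<close>.
\<close>

definition cutoff :: "nat \<Rightarrow> real \<Rightarrow> real" where
  "cutoff n x = exp_step 1 (real n * (x - 1 / (real n + 3))) * exp_step 1 (real n * (1 - 1 / (real n + 3) - x))"

lemma smooth_cutoff: "smooth (cutoff n)"
proof -
  have "smooth (\<lambda>x. exp_step 1 (real n * x + (- real n / (real n + 3))) *
                     exp_step 1 (- real n * x + real n * (1 - 1 / (real n + 3))))"
    by (intro smooth_mult smooth_affine smooth_exp_step)
  then show ?thesis unfolding cutoff_def[abs_def] by (simp add: algebra_simps)
qed

lemma cutoff_bounds: "\<bar>cutoff n x\<bar> \<le> 1"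
proof -
  have "0 \<le> exp_step 1 y \<and> exp_step 1 y \<le> 1" for y by (auto simp: exp_step_def)
  then show ?thesis unfolding cutoff_def abs_mult by (intro mult_le_one) simp_all
qed

lemma closure_cutoff: "closure {x. cutoff n x \<noteq> 0} \<subseteq> {0<..<1}"
proof -
  have "{x. cutoff n x \<noteq> 0} \<subseteq> {1 / (real n + 3) .. 1 - 1 / (real n + 3)}"
    by (auto simp: cutoff_def exp_step_def zero_less_mult_iff split: if_splits)
  then have "closure {x. cutoff n x \<noteq> 0} \<subseteq> {1 / (real n + 3) .. 1 - 1 / (real n + 3)}"
    by (rule closure_minimal) simp
  moreover have "{e..1 - e} \<subseteq> {0<..<1}" if "0 < e" for e :: real
    using that by auto
  ultimately show ?thesis by (meson order_trans of_nat_0_le_iff add_nonneg_pos zero_less_divide_1_iff zero_less_numeral)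
qed

lemma cutoff_tendsto_1:
  assumes "0 < x" "x < 1"
  shows "(\<lambda>n. cutoff n x) \<longlonglongrightarrow> 1"
proof -
  have 1: "((exp_step 1) \<longlongrightarrow> 1) at_top"
  proof (rule Lim_transform_eventually)
    show "((\<lambda>x::real. exp (- (inverse x))) \<longlongrightarrow> 1) at_top"
      using tendsto_exp[OF tendsto_minus[OF tendsto_inverse_0_at_top[OF filterlim_ident]]] by simp
    show "\<forall>\<^sub>F x in at_top. exp (- (inverse x)) = exp_step 1 x"
      using eventually_gt_at_top[of "0::real"] by eventually_elim (simp add: exp_step_def divide_inverse)
  qed
  have lim: "filterlim (\<lambda>n. real n * (y - 1 / (real n + 3))) at_top sequentially" if "y > 0" for y
  proof (rule filterlim_at_top_mono)
    have "filterlim (\<lambda>n. y * real n) at_top sequentially"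
      using that by (intro filterlim_tendsto_pos_mult_at_top[OF tendsto_const] filterlim_real_sequentially)
    then show "filterlim (\<lambda>n. - 1 + y * real n) at_top sequentially"
      by (intro filterlim_tendsto_add_at_top[OF tendsto_const])
    have "- 1 + y * real n \<le> real n * (y - 1 / (real n + 3))" for n
      by (simp add: field_simps)
    then show "\<forall>\<^sub>F n in sequentially. - 1 + y * real n \<le> real n * (y - 1 / (real n + 3))"
      by simp
  qed
  have "(\<lambda>n. cutoff n x) \<longlonglongrightarrow> 1 * 1"
    unfolding cutoff_def
    using lim[of x] lim[of "1 - x"] assms
    by (intro tendsto_mult filterlim_compose[OF 1]) (auto simp: algebra_simps)
  then show ?thesis by simp
qed

lemma test_cutoff: "test_fun (cutoff n)"
  by (simp add: test_fun_iff smooth_cutoff closure_cutoff)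

lemma test_fun_smooth: "test_fun \<phi> \<Longrightarrow> smooth \<phi>"
  by (simp add: test_fun_iff)

lemma test_fun_support:
  assumes "test_fun \<phi>"
  obtains a b where "0 < a" "a < b" "b < 1" "\<And>x. x < a \<or> b < x \<Longrightarrow> \<phi> x = 0"
proof -
  \<comment> \<open>The two extra points make the support nonempty and its bounds distinct.\<close>
  define S where "S = insert (1/3) (insert (1/2) (closure {x. \<phi> x \<noteq> 0}))"
  have sub: "S \<subseteq> {0<..<1}" using assms by (auto simp: S_def test_fun_iff)
  then have "bounded S" by (rule bounded_subset[OF bounded_box[of 0 "1::real", unfolded box_real]])
  moreover have "closed S" by (simp add: S_def)
  ultimately have "compact S" by (simp add: compact_eq_bounded_closed)
  moreover have "S \<noteq> {}" by (simp add: S_def)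
  ultimately obtain a b where ab: "a \<in> S" "b \<in> S" "\<And>x. x \<in> S \<Longrightarrow> a \<le> x" "\<And>x. x \<in> S \<Longrightarrow> x \<le> b"
    using compact_attains_inf[of S] compact_attains_sup[of S] by blast
  have "a \<le> 1/3" "1/2 \<le> b" using ab(3)[of "1/3"] ab(4)[of "1/2"] by (simp_all add: S_def)
  then have "a < b" by simp
  moreover have "0 < a" "b < 1" using ab(1,2) sub by auto
  moreover have "\<phi> x = 0" if "x < a \<or> b < x" for x
  proof (rule ccontr)
    assume "\<phi> x \<noteq> 0"
    then have "x \<in> S"
      using closure_subset[of "{x. \<phi> x \<noteq> 0}"] by (auto simp: S_def)
    then show False using ab(3)[of x] ab(4)[of x] that by simp
  qed
  ultimately show thesis using that by blast
qed

lemma test_fun_eq_0: "test_fun \<phi> \<Longrightarrow> x \<le> 0 \<or> 1 \<le> x \<Longrightarrow> \<phi> x = 0"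
  by (elim test_fun_support) auto

lemma test_funI:
  assumes "smooth \<phi>" "0 < a" "b < 1" "\<And>x. x < a \<or> b < x \<Longrightarrow> \<phi> x = 0"
  shows "test_fun \<phi>"
proof -
  have "{x. \<phi> x \<noteq> 0} \<subseteq> {a..b}"
    using assms(4) by (metis (mono_tags, lifting) atLeastAtMost_iff mem_Collect_eq not_le subsetI)
  then have "closure {x. \<phi> x \<noteq> 0} \<subseteq> {a..b}"
    by (rule closure_minimal) simp
  then show ?thesis using assms by (auto simp: test_fun_iff)
qed

lemma test_fun_mult: "smooth f \<Longrightarrow> test_fun \<phi> \<Longrightarrow> test_fun (\<lambda>x. f x * \<phi> x)"
  by (rule test_fun_support, assumption, rule test_funI) (auto intro: smooth_mult test_fun_smooth)

lemma test_fun_diff: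
  assumes "test_fun \<phi>" "test_fun \<psi>"
  shows "test_fun (\<lambda>x. \<phi> x - \<psi> x)"
proof -
  obtain a b where 1: "0 < a" "b < 1" "\<And>x. x < a \<or> b < x \<Longrightarrow> \<phi> x = 0"
    using test_fun_support[OF assms(1)] by metis
  obtain c d where 2: "0 < c" "d < 1" "\<And>x. x < c \<or> d < x \<Longrightarrow> \<psi> x = 0"
    using test_fun_support[OF assms(2)] by metis
  show ?thesis
    by (rule test_funI[of _ "min a c" "max b d"])
      (use 1 2 assms in \<open>auto intro: smooth_diff test_fun_smooth\<close>)
qed

text \<open>
  The primitive that starts left of the support vanishes there, and it vanishes to the right of the
  support because the total integral is \<open>0\<close>.
\<close>

lemma test_fun_antideriv:
  assumes "test_fun \<phi>" and mean: "integral {0..1} \<phi> = 0"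
  obtains \<Phi> where "test_fun \<Phi>" "deriv \<Phi> = \<phi>"
proof -
  obtain a b where ab: "0 < a" "a < b" "b < 1" "\<And>x. x < a \<or> b < x \<Longrightarrow> \<phi> x = 0"
    using test_fun_support[OF assms(1)] by metis
  define \<Phi> where "\<Phi> x = integral {- 1..x} \<phi>" for x
  have low: "\<Phi> x = 0" if "x < a" for x
    unfolding \<Phi>_def by (rule integral_unique, rule has_integral_is_0) (use that ab(4) in auto)
  have high: "\<Phi> x = 0" if "b < x" for x
  proof -
    have "integral UNIV (\<lambda>t. if t \<in> {- 1..x} then \<phi> t else 0) = integral UNIV (\<lambda>t. if t \<in> {0..1} then \<phi> t else 0)"
      by (rule arg_cong[where f = "integral UNIV"]) (use that ab in force)
    then show ?thesis unfolding integral_restrict_UNIV using mean by (simp add: \<Phi>_def)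
  qed
  have d: "(\<Phi> has_field_derivative \<phi> x) (at x)" for x
  proof (cases "x < a")
    case True
    have "((\<lambda>x. 0) has_field_derivative 0) (at x)" by simp
    then have "(\<Phi> has_field_derivative 0) (at x)"
      by (rule has_field_derivative_transform_within_open[of _ _ _ "{..<a}"]) (use True low in auto)
    then show ?thesis using True ab by simp
  next
    case False
    have "continuous_on {- 1..x + 1} \<phi>"
      by (intro continuous_on_smooth test_fun_smooth assms)
    then have "((\<lambda>x. integral {- 1..x} \<phi>) has_real_derivative \<phi> x) (at x within {- 1..x + 1})"
      by (rule integral_has_real_derivative) (use False ab in auto)
    moreover have "at x within {- 1..x + 1} = at x"
      by (rule at_within_interior) (use False ab in auto)
    ultimately show ?thesis by (simp add: \<Phi>_def[abs_def])
  qed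
  have "smooth \<Phi>" using smooth_antideriv[OF d test_fun_smooth[OF assms(1)]] .
  then have "test_fun \<Phi>"
    by (rule test_funI[of _ a b]) (use ab low high in \<open>auto simp: not_le\<close>)
  moreover have "deriv \<Phi> = \<phi>" by (auto intro!: DERIV_imp_deriv d)
  ultimately show thesis by (rule that)
qed

section \<open>Integration over the unit interval\<close>

lemma integrable_I01_iff: "integrable I01 f \<longleftrightarrow> f absolutely_integrable_on {0..1}"
  for f :: "real \<Rightarrow> real"
  using absolutely_integrable_on_open_interval[where f = f and a = "0::real" and b = 1]
  by (simp add: integrable_restrict_space set_integrable_def)

lemma I01_integral:
  fixes f :: "real \<Rightarrow> real"
  assumes "integrable I01 f"
  shows "(LINT x|I01. f x) = integral {0..1} f"
  using lebesgue_integral_eq_integral[OF assms] integral_open_interval_real[of "0::real" 1 f] by simp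

lemma integrable_I01_continuous:
  "continuous_on {0..1} f \<Longrightarrow> integrable I01 f" for f :: "real \<Rightarrow> real"
  unfolding integrable_I01_iff by (rule absolutely_integrable_continuous_real)

lemma measurable_I01_continuous:
  "continuous_on {0..1} f \<Longrightarrow> f \<in> borel_measurable I01" for f :: "real \<Rightarrow> real"
  by (rule borel_measurable_integrable[OF integrable_I01_continuous])

lemma I01_const: "(LINT x|I01. c) = (c::real)"
  using I01_integral[OF integrable_I01_continuous, of "\<lambda>x. c"] by simp

lemma AE_I01I: "(\<And>x. 0 < x \<Longrightarrow> x < 1 \<Longrightarrow> P x) \<Longrightarrow> AE x in I01. P x"
  by (rule AE_I2) simp

lemma AE_I01_not_False: "\<not> (AE x in I01. False)"
proof
  assume "AE x in I01. False"
  then have "AE x in I01. (1::real) = 0" by simp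
  then have "(LINT x|I01. 1::real) = 0" by (rule integral_eq_zero_AE)
  then show False by (simp only: I01_const)
qed

lemma continuous_on_I01_bounded:
  fixes f :: "real \<Rightarrow> real"
  assumes "continuous_on {a..b} f"
  obtains C where "\<And>x. a \<le> x \<Longrightarrow> x \<le> b \<Longrightarrow> \<bar>f x\<bar> \<le> C" "0 \<le> C"
proof -
  have "bounded (f ` {a..b})"
    by (intro compact_imp_bounded compact_continuous_image assms compact_Icc)
  then obtain C where "\<forall>x\<in>{a..b}. \<bar>f x\<bar> \<le> C" "0 < C" by (auto simp: bounded_pos)
  then show thesis by (intro that[of C]) auto
qed

lemma integrable_mult_bounded:
  fixes f g :: "real \<Rightarrow> real"
  assumes "integrable I01 f" "g \<in> borel_measurable I01" "AE x in I01. \<bar>g x\<bar> \<le> C"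
  shows "integrable I01 (\<lambda>x. f x * g x)"
proof (rule Bochner_Integration.integrable_bound)
  show "integrable I01 (\<lambda>x. C * f x)" using assms(1) by simp
  show "(\<lambda>x. f x * g x) \<in> borel_measurable I01" using assms by measurable
  show "AE x in I01. norm (f x * g x) \<le> norm (C * f x)"
    using assms(3)
  proof eventually_elim
    case (elim x)
    then have "\<bar>g x\<bar> * \<bar>f x\<bar> \<le> \<bar>C\<bar> * \<bar>f x\<bar>" by (intro mult_right_mono) auto
    then show ?case by (simp add: abs_mult mult.commute)
  qed
qed

lemma integrable_mult_continuous:
  fixes f g :: "real \<Rightarrow> real"
  assumes "integrable I01 f" "continuous_on {0..1} g"
  shows "integrable I01 (\<lambda>x. f x * g x)"
proof -
  obtain C where "\<And>x. 0 \<le> x \<Longrightarrow> x \<le> 1 \<Longrightarrow> \<bar>g x\<bar> \<le> C"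
    using continuous_on_I01_bounded[OF assms(2)] by blast
  then show ?thesis
    by (intro integrable_mult_bounded[of _ _ C] assms measurable_I01_continuous AE_I01I) auto
qed

lemma I01_FTC:
  assumes "\<And>x. 0 \<le> x \<Longrightarrow> x \<le> 1 \<Longrightarrow> (f has_real_derivative f' x) (at x within {0..1})"
    and "continuous_on {0..1} f'"
  shows "(LINT x|I01. f' x) = f 1 - f 0"
proof -
  have "(f' has_integral f 1 - f 0) {0..1}"
    by (rule fundamental_theorem_of_calculus)
      (use assms(1) in \<open>auto simp: has_real_derivative_iff_has_vector_derivative\<close>)
  then show ?thesis
    using I01_integral[OF integrable_I01_continuous[OF assms(2)]] by (simp add: integral_unique)
qed

lemma Lp_1_iff: "f \<in> Lp 1 \<longleftrightarrow> integrable I01 f"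
proof -
  have "integrable I01 (\<lambda>x. \<bar>f x\<bar> powr 1) \<longleftrightarrow> integrable I01 (\<lambda>x. \<bar>f x\<bar>)" by simp
  then show ?thesis
    by (auto simp: Lp_def integrable_abs_iff borel_measurable_integrable simp del: powr_one_gt_zero_iff)
qed

lemma powr_abs_2: "\<bar>y\<bar> powr 2 = (y::real)\<^sup>2"
  by (cases "y = 0") (auto simp: powr_numeral)

lemma Lp_2_iff: "f \<in> Lp 2 \<longleftrightarrow> f \<in> borel_measurable I01 \<and> integrable I01 (\<lambda>x. (f x)\<^sup>2)"
  by (simp add: Lp_def powr_abs_2)

lemma Lp_norm_2: "Lp_norm 2 f = sqrt (LINT x|I01. (f x)\<^sup>2)"
  by (simp add: Lp_norm_def powr_abs_2 powr_half_sqrt)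

lemma Lp_2_integrable:
  assumes "f \<in> Lp 2"
  shows "integrable I01 f"
proof (rule Bochner_Integration.integrable_bound)
  show "integrable I01 (\<lambda>x. 1 + (f x)\<^sup>2)"
    using assms integrable_I01_continuous[of "\<lambda>x. 1"] by (simp add: Lp_2_iff)
  show "AE x in I01. norm (f x) \<le> norm (1 + (f x)\<^sup>2)"
  proof (rule AE_I2)
    fix x
    have "0 \<le> (\<bar>f x\<bar> - 1)\<^sup>2 + \<bar>f x\<bar>" by simp
    then show "norm (f x) \<le> norm (1 + (f x)\<^sup>2)" by (simp add: power2_eq_square algebra_simps)
  qed
qed (use assms in \<open>simp add: Lp_2_iff\<close>)

lemma Lp_2_diff:
  assumes "f \<in> Lp 2" "g \<in> Lp 2"
  shows "(\<lambda>x. f x - g x) \<in> Lp 2"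
proof -
  have [measurable]: "f \<in> borel_measurable I01" "g \<in> borel_measurable I01"
    using assms by (auto simp: Lp_2_iff)
  have "integrable I01 (\<lambda>x. (f x - g x)\<^sup>2)"
  proof (rule Bochner_Integration.integrable_bound)
    show "integrable I01 (\<lambda>x. 2 * (f x)\<^sup>2 + 2 * (g x)\<^sup>2)"
      using assms by (auto simp: Lp_2_iff)
    show "AE x in I01. norm ((f x - g x)\<^sup>2) \<le> norm (2 * (f x)\<^sup>2 + 2 * (g x)\<^sup>2)"
    proof (rule AE_I2)
      fix x
      have "2 * (f x)\<^sup>2 + 2 * (g x)\<^sup>2 - (f x - g x)\<^sup>2 = (f x + g x)\<^sup>2"
        by (simp add: power2_eq_square algebra_simps)
      then show "norm ((f x - g x)\<^sup>2) \<le> norm (2 * (f x)\<^sup>2 + 2 * (g x)\<^sup>2)"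
        by (simp add: abs_of_nonneg) (metis diff_ge_0_iff_ge zero_le_power2)
    qed
  qed simp
  then show ?thesis by (simp add: Lp_2_iff)
qed

lemma Lp_2_continuous: "continuous_on {0..1} f \<Longrightarrow> f \<in> Lp 2"
  by (simp add: Lp_2_iff measurable_I01_continuous integrable_I01_continuous continuous_on_power)

text \<open>
  The Cauchy--Schwarz inequality on a space of total mass \<open>1\<close>, in the form that the variance of
  \<open>\<bar>f\<bar>\<close> is nonnegative.
\<close>

lemma L1_le_L2:
  assumes "f \<in> Lp 2"
  shows "(LINT x|I01. \<bar>f x\<bar>) \<le> Lp_norm 2 f"
proof -
  define m where "m = (LINT x|I01. \<bar>f x\<bar>)"
  have i1: "integrable I01 (\<lambda>x. 2 * m * \<bar>f x\<bar>)"
    using Lp_2_integrable[OF assms] by simp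
  have i2: "integrable I01 (\<lambda>x. (f x)\<^sup>2)"
    using assms by (simp add: Lp_2_iff)
  have i3: "integrable I01 (\<lambda>x. m\<^sup>2)"
    by (intro integrable_I01_continuous continuous_on_const)
  have "0 \<le> (LINT x|I01. (\<bar>f x\<bar> - m)\<^sup>2)" by (rule integral_nonneg_AE) simp
  also have "\<dots> = (LINT x|I01. (f x)\<^sup>2 - 2 * m * \<bar>f x\<bar> + m\<^sup>2)"
    by (rule arg_cong[where f = "integral\<^sup>L I01"]) (simp add: fun_eq_iff power2_eq_square algebra_simps)
  also have "\<dots> = (LINT x|I01. (f x)\<^sup>2 - 2 * m * \<bar>f x\<bar>) + (LINT x|I01. m\<^sup>2)"
    by (intro Bochner_Integration.integral_add Bochner_Integration.integrable_diff i1 i2 i3)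
  also have "\<dots> = (LINT x|I01. (f x)\<^sup>2) - 2 * m * m + m\<^sup>2"
    unfolding I01_const Bochner_Integration.integral_diff[OF i2 i1] by (simp add: m_def)
  finally have "m\<^sup>2 \<le> (LINT x|I01. (f x)\<^sup>2)" by (simp add: power2_eq_square)
  then have "sqrt (m\<^sup>2) \<le> Lp_norm 2 f" unfolding Lp_norm_2 by (rule real_sqrt_le_mono)
  then show ?thesis by (simp add: m_def)
qed

section \<open>Approximation by continuous functions\<close>

text \<open>
  Lebesgue measurable functions are limits almost everywhere of continuous ones; truncating the
  approximants at the bound of the limit keeps the limit and makes dominated convergence available.
\<close>

lemma continuous_approx_AE:
  assumes "f \<in> borel_measurable I01" "AE x in I01. \<bar>f x\<bar> \<le> C" "0 \<le> C"
  obtains g :: "nat \<Rightarrow> real \<Rightarrow> real" where "\<And>n. continuous_on UNIV (g n)" "\<And>n x. \<bar>g n x\<bar> \<le> C"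
    "AE x in I01. (\<lambda>n. g n x) \<longlonglongrightarrow> f x"
proof -
  have "f measurable_on {0<..<1}"
    using assms by (simp add: measurable_on_iff_borel_measurable)
  then obtain N g where N: "negligible N" and g: "\<And>n. continuous_on UNIV (g n)"
    and lim: "\<And>x. x \<notin> N \<Longrightarrow> (\<lambda>n. g n x) \<longlonglongrightarrow> (if x \<in> {0<..<1} then f x else 0)"
    unfolding measurable_on_def by blast
  have "AE x in lebesgue. x \<notin> N"
    using N AE_not_in negligible_iff_null_sets by blast
  then have N: "AE x in I01. x \<notin> N" by (auto simp: AE_restrict_space_iff)
  have "AE x in I01. (\<lambda>n. max (- C) (min C (g n x))) \<longlonglongrightarrow> f x"
    using N assms(2) AE_space
  proof eventually_elim
    case (elim x)
    then have "(\<lambda>n. max (- C) (min C (g n x))) \<longlonglongrightarrow> max (- C) (min C (f x))"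
      using lim[of x] by (intro tendsto_intros) auto
    with elim show ?case by (simp add: abs_le_iff)
  qed
  then show thesis
    using \<open>0 \<le> C\<close> g by (intro that[of "\<lambda>n x. max (- C) (min C (g n x))"]) (auto intro!: continuous_intros)
qed

text \<open>
  Truncate at a high level first, then approximate the bounded truncation; both steps are dominated
  convergence.
\<close>

lemma continuous_L1_dense:
  assumes f: "integrable I01 f" and "0 < e"
  obtains g :: "real \<Rightarrow> real" where "continuous_on UNIV g" "(LINT x|I01. \<bar>g x - f x\<bar>) < e"
proof -
  have [measurable]: "f \<in> borel_measurable I01" using f by simp
  have c: "integrable I01 g" if "continuous_on UNIV g" for g :: "real \<Rightarrow> real"
    using that by (intro integrable_I01_continuous) (rule continuous_on_subset, auto)
  define F where "F k x = max (- real k) (min (real k) (f x))" for k x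
  have [measurable]: "F k \<in> borel_measurable I01" for k unfolding F_def by measurable
  have "(\<lambda>k. LINT x|I01. \<bar>F k x - f x\<bar>) \<longlonglongrightarrow> (LINT x|I01. 0)"
  proof (rule integral_dominated_convergence)
    show "integrable I01 (\<lambda>x. \<bar>f x\<bar>)" using f by simp
    show "AE x in I01. (\<lambda>k. \<bar>F k x - f x\<bar>) \<longlonglongrightarrow> 0"
    proof (rule AE_I2, rule tendsto_eventually)
      fix x
      obtain N where "\<bar>f x\<bar> \<le> real N" using real_arch_simple by blast
      then have "\<bar>F k x - f x\<bar> = 0" if "N \<le> k" for k
        using that by (auto simp: F_def)
      then show "\<forall>\<^sub>F k in sequentially. \<bar>F k x - f x\<bar> = 0"
        by (auto simp: eventually_sequentially)
    qed
  qed (auto simp: F_def)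
  then have "\<forall>\<^sub>F k in sequentially. (LINT x|I01. \<bar>F k x - f x\<bar>) < e / 2"
    using \<open>0 < e\<close> by (intro order_tendstoD) auto
  then obtain k where k: "(LINT x|I01. \<bar>F k x - f x\<bar>) < e / 2"
    by (auto simp: eventually_sequentially)
  have Fk: "\<bar>F k x\<bar> \<le> real k" for x by (auto simp: F_def)
  then have iF: "integrable I01 (F k)"
    by (intro Bochner_Integration.integrable_bound[OF integrable_I01_continuous[of "\<lambda>x. real k"]]) auto
  obtain g where g: "\<And>n. continuous_on UNIV (g n)" "\<And>n x. \<bar>g n x\<bar> \<le> real k"
    "AE x in I01. (\<lambda>n. g n x) \<longlonglongrightarrow> F k x"
    using continuous_approx_AE[of "F k" "real k"] Fk by auto
  have [measurable]: "g n \<in> borel_measurable I01" for n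
    using c[OF g(1)] by simp
  have "(\<lambda>n. LINT x|I01. \<bar>g n x - F k x\<bar>) \<longlonglongrightarrow> (LINT x|I01. 0)"
  proof (rule integral_dominated_convergence)
    show "integrable I01 (\<lambda>x. 2 * real k)" by (intro integrable_I01_continuous) simp
    show "AE x in I01. (\<lambda>n. \<bar>g n x - F k x\<bar>) \<longlonglongrightarrow> 0"
      using g(3) by eventually_elim (auto intro!: tendsto_rabs_zero simp: LIM_zero)
    show "AE x in I01. norm \<bar>g n x - F k x\<bar> \<le> 2 * real k" for n
      using g(2)[of n] Fk by (intro AE_I2) (smt (verit) real_norm_def)
  qed auto
  then have "\<forall>\<^sub>F n in sequentially. (LINT x|I01. \<bar>g n x - F k x\<bar>) < e / 2"
    using \<open>0 < e\<close> by (intro order_tendstoD) auto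
  then obtain n where n: "(LINT x|I01. \<bar>g n x - F k x\<bar>) < e / 2"
    by (auto simp: eventually_sequentially)
  have "(LINT x|I01. \<bar>g n x - f x\<bar>) \<le> (LINT x|I01. \<bar>g n x - F k x\<bar> + \<bar>F k x - f x\<bar>)"
    by (rule integral_mono) (use c[OF g(1)] iF f in auto)
  also have "\<dots> = (LINT x|I01. \<bar>g n x - F k x\<bar>) + (LINT x|I01. \<bar>F k x - f x\<bar>)"
    by (rule Bochner_Integration.integral_add) (use c[OF g(1)] iF f in auto)
  also have "\<dots> < e" using k n by simp
  finally show thesis using that g(1) by blast
qed

section \<open>The fundamental lemma of the calculus of variations\<close>

text \<open>
  Orthogonality to test functions spreads by limits. Cut-offs times a polynomial are test
  functions, so \<open>g\<close> is orthogonal to all polynomials; by Weierstrass it is orthogonal to all continuous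
  functions; and continuous functions approximate \<open>sgn g\<close> boundedly, so the integral of \<open>\<bar>g\<bar>\<close>
  is \<open>0\<close>.
\<close>

lemma fundamental_lemma:
  assumes g: "integrable I01 g"
    and test: "\<And>\<phi>. test_fun \<phi> \<Longrightarrow> (LINT x|I01. g x * \<phi> x) = 0"
  shows "AE x in I01. g x = 0"
proof -
  have [measurable]: "g \<in> borel_measurable I01" using g by simp
  have poly: "(LINT x|I01. g x * p x) = 0" if p: "real_polynomial_function p" for p
  proof -
    have sp: "smooth p" by (rule smooth_real_polynomial_function[OF p])
    then have [measurable]: "p \<in> borel_measurable I01"
      by (intro measurable_I01_continuous continuous_on_smooth)
    have [measurable]: "cutoff n \<in> borel_measurable I01" for n
      by (intro measurable_I01_continuous continuous_on_smooth smooth_cutoff)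
    have "(\<lambda>n. LINT x|I01. g x * (p x * cutoff n x)) \<longlonglongrightarrow> (LINT x|I01. g x * (p x * 1))"
    proof (rule integral_dominated_convergence)
      show "integrable I01 (\<lambda>x. \<bar>g x * p x\<bar>)"
        by (intro integrable_abs integrable_mult_continuous g continuous_on_smooth sp)
      show "AE x in I01. (\<lambda>n. g x * (p x * cutoff n x)) \<longlonglongrightarrow> g x * (p x * 1)"
        by (intro AE_I01I tendsto_intros cutoff_tendsto_1)
      show "AE x in I01. norm (g x * (p x * cutoff n x)) \<le> \<bar>g x * p x\<bar>" for n
        using cutoff_bounds by (intro AE_I2) (auto simp: abs_mult mult_left_le simp flip: mult.assoc)
    qed measurable
    then show ?thesis
      using test[OF test_fun_mult[OF sp test_cutoff]] LIMSEQ_unique[OF tendsto_const] by fastforce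
  qed
  have cont: "(LINT x|I01. g x * s x) = 0" if s: "continuous_on {0..1} s" for s
  proof (rule ccontr)
    define J where "J = (LINT x|I01. \<bar>g x\<bar>)"
    have "0 \<le> J" by (simp add: J_def)
    assume "(LINT x|I01. g x * s x) \<noteq> 0"
    define e where "e = \<bar>LINT x|I01. g x * s x\<bar> / (J + 1)"
    have "0 < e" using \<open>_ \<noteq> 0\<close> \<open>0 \<le> J\<close> by (auto simp: e_def)
    then obtain p where p: "real_polynomial_function p" "\<And>x. x \<in> {0..1} \<Longrightarrow> \<bar>s x - p x\<bar> < e"
      using Stone_Weierstrass_real_polynomial_function[OF compact_Icc s] by metis
    have cp: "continuous_on {0..1} p"
      by (intro continuous_on_smooth smooth_real_polynomial_function p)
    have i: "integrable I01 (\<lambda>x. g x * s x)" "integrable I01 (\<lambda>x. g x * p x)"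
      "integrable I01 (\<lambda>x. g x * (s x - p x))"
      by (intro integrable_mult_continuous g s cp continuous_intros)+
    have "(LINT x|I01. g x * s x) = (LINT x|I01. g x * (s x - p x)) + (LINT x|I01. g x * p x)"
      using Bochner_Integration.integral_add[OF i(3,2)] by (simp add: algebra_simps)
    also have "\<dots> = (LINT x|I01. g x * (s x - p x))" by (simp add: poly[OF p(1)])
    also have "\<bar>\<dots>\<bar> \<le> (LINT x|I01. \<bar>g x * (s x - p x)\<bar>)" by (rule integral_abs_bound)
    also have "\<dots> \<le> (LINT x|I01. e * \<bar>g x\<bar>)"
    proof (rule integral_mono_AE)
      show "AE x in I01. \<bar>g x * (s x - p x)\<bar> \<le> e * \<bar>g x\<bar>"
      proof (rule AE_I01I)
        fix x :: real assume "0 < x" "x < 1"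
        then have "\<bar>s x - p x\<bar> \<le> e" using p(2)[of x] by simp
        then have "\<bar>s x - p x\<bar> * \<bar>g x\<bar> \<le> e * \<bar>g x\<bar>" by (intro mult_right_mono) auto
        then show "\<bar>g x * (s x - p x)\<bar> \<le> e * \<bar>g x\<bar>" by (simp add: abs_mult mult.commute)
      qed
    qed (use i g in auto)
    also have "\<dots> = e * J" by (simp add: J_def)
    finally show False using \<open>0 < e\<close> \<open>0 \<le> J\<close> by (simp add: e_def field_simps)
  qed
  obtain s where s: "\<And>n. continuous_on UNIV (s n)" "\<And>n x. \<bar>s n x\<bar> \<le> 1"
    "AE x in I01. (\<lambda>n. s n x) \<longlonglongrightarrow> sgn (g x)"
    using continuous_approx_AE[of "\<lambda>x. sgn (g x)" 1] by (auto simp: sgn_if)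
  have cs: "continuous_on {0..1} (s n)" for n using s(1) continuous_on_subset by blast
  then have [measurable]: "s n \<in> borel_measurable I01" for n by (rule measurable_I01_continuous)
  have "(\<lambda>n. LINT x|I01. g x * s n x) \<longlonglongrightarrow> (LINT x|I01. g x * sgn (g x))"
  proof (rule integral_dominated_convergence)
    show "AE x in I01. (\<lambda>n. g x * s n x) \<longlonglongrightarrow> g x * sgn (g x)"
      using s(3) by eventually_elim (intro tendsto_intros)
    show "integrable I01 (\<lambda>x. \<bar>g x\<bar>)" using g by simp
    show "AE x in I01. norm (g x * s n x) \<le> \<bar>g x\<bar>" for n
      using s(2) by (intro AE_I2) (auto simp: abs_mult mult_left_le)
  qed measurable
  then have "(LINT x|I01. norm (g x)) = 0"
    using cont[OF cs] LIMSEQ_unique[OF tendsto_const, of 0] by (simp flip: abs_sgn)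
  then show ?thesis using integral_nonneg_eq_0_iff_AE[of I01 "\<lambda>x. norm (g x)"] g by simp
qed

text \<open>
  Subtracting from a test function its mean times a fixed test function \<open>\<psi>\<close> of integral \<open>1\<close> leaves
  the derivative of a test function. Hence \<open>w\<close> minus its \<open>\<psi>\<close>-average is orthogonal to all test
  functions.
\<close>

lemma du_Bois_Reymond:
  assumes w: "integrable I01 w"
    and test: "\<And>\<phi>. test_fun \<phi> \<Longrightarrow> (LINT x|I01. w x * deriv \<phi> x) = 0"
  obtains c where "AE x in I01. w x = c"
proof -
  have ti: "integrable I01 (\<lambda>x. h x * \<phi> x)" if "test_fun \<phi>" "integrable I01 h" for \<phi> h
    by (intro integrable_mult_continuous that continuous_on_smooth test_fun_smooth)
  have 1: "integrable I01 (\<lambda>x. 1::real)" by (intro integrable_I01_continuous) simp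
  have "\<not> (AE x in I01. (1::real) = 0)" using AE_I01_not_False by simp
  \<comment> \<open>If all test functions had mean \<open>0\<close>, the constant \<open>1\<close> would vanish almost everywhere.\<close>
  then obtain \<psi>0 where \<psi>0: "test_fun \<psi>0" "(LINT x|I01. \<psi>0 x) \<noteq> 0"
    using fundamental_lemma[OF 1] by auto
  define \<psi> where "\<psi> x = \<psi>0 x / (LINT x|I01. \<psi>0 x)" for x
  have \<psi>: "test_fun \<psi>"
    using test_fun_mult[OF smooth_const[of "inverse (LINT x|I01. \<psi>0 x)"] \<psi>0(1)] unfolding \<psi>_def[abs_def] divide_inverse
    by (simp add: mult.commute)
  have \<psi>1: "(LINT x|I01. \<psi> x) = 1" using \<psi>0(2) by (simp add: \<psi>_def)
  define c where "c = (LINT x|I01. w x * \<psi> x)"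
  have "AE x in I01. w x - c = 0"
  proof (rule fundamental_lemma)
    show "integrable I01 (\<lambda>x. w x - c)" using w 1 integrable_mult_right[OF 1, of c] by simp
    fix \<phi> assume \<phi>: "test_fun \<phi>"
    define m where "m = (LINT x|I01. \<phi> x)"
    have t: "test_fun (\<lambda>x. \<phi> x - m * \<psi> x)"
      by (intro test_fun_diff test_fun_mult smooth_const \<phi> \<psi>)
    have i: "integrable I01 \<phi>" "integrable I01 \<psi>" using ti[OF _ 1] \<phi> \<psi> by simp_all
    have "(LINT x|I01. \<phi> x - m * \<psi> x) = 0" using i \<psi>1 by (simp add: m_def)
    moreover have "integrable I01 (\<lambda>x. \<phi> x - m * \<psi> x)" using i by simp
    ultimately have "integral {0..1} (\<lambda>x. \<phi> x - m * \<psi> x) = 0" using I01_integral by metis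
    then obtain \<Phi> where "test_fun \<Phi>" "deriv \<Phi> = (\<lambda>x. \<phi> x - m * \<psi> x)"
      using test_fun_antideriv[OF t] by blast
    then have "0 = (LINT x|I01. w x * (\<phi> x - m * \<psi> x))" using test[of \<Phi>] by simp
    also have "\<dots> = (LINT x|I01. w x * \<phi> x - m * (w x * \<psi> x))" by (simp add: algebra_simps)
    also have "\<dots> = (LINT x|I01. w x * \<phi> x) - m * c"
      using ti[OF \<phi> w] ti[OF \<psi> w] by (simp add: c_def)
    also have "\<dots> = (LINT x|I01. w x * \<phi> x - c * \<phi> x)"
      using ti[OF \<phi> w] i by (simp add: m_def)
    finally show "(LINT x|I01. (w x - c) * \<phi> x) = 0" by (simp add: algebra_simps)
  qed
  then show thesis by (intro that[of c]) simp
qed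

section \<open>Primitives of integrable functions\<close>

definition primitive :: "(real \<Rightarrow> real) \<Rightarrow> real \<Rightarrow> real" where
  "primitive f x = integral {0..x} f"

lemma integrable_on_initial:
  fixes f :: "real \<Rightarrow> real"
  assumes "integrable I01 f" "x \<le> 1"
  shows "f absolutely_integrable_on {0..x}"
  by (rule set_integrable_subset[of _ "{0..1}"]) (use assms in \<open>auto simp: integrable_I01_iff\<close>)

lemma continuous_on_primitive: "integrable I01 f \<Longrightarrow> continuous_on {0..1} (primitive f)"
  unfolding primitive_def[abs_def]
  by (rule indefinite_integral_continuous_1)
    (auto simp: integrable_I01_iff set_lebesgue_integral_eq_integral)

lemma primitive_has_derivative:
  assumes "continuous_on {0..1} f" "0 \<le> x" "x \<le> 1"
  shows "(primitive f has_real_derivative f x) (at x within {0..1})"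
  unfolding primitive_def[abs_def]
  by (rule integral_has_real_derivative) (use assms in auto)

lemma primitive_diff_le:
  assumes f: "integrable I01 f" and g: "integrable I01 g" and "0 \<le> x" "x \<le> 1"
  shows "\<bar>primitive f x - primitive g x\<bar> \<le> (LINT t|I01. \<bar>f t - g t\<bar>)"
proof -
  have i: "integrable I01 (\<lambda>t. f t - g t)" "integrable I01 (\<lambda>t. \<bar>f t - g t\<bar>)"
    using f g by simp_all
  note on = integrable_on_initial[THEN set_lebesgue_integral_eq_integral(1)]
  have "primitive f x - primitive g x = integral {0..x} (\<lambda>t. f t - g t)"
    unfolding primitive_def
    by (rule Henstock_Kurzweil_Integration.integral_diff[symmetric]) (intro on f g \<open>x \<le> 1\<close>)+
  also have "\<bar>\<dots>\<bar> \<le> integral {0..x} (\<lambda>t. \<bar>f t - g t\<bar>)"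
    using integral_norm_bound_integral[OF on[OF i(1) \<open>x \<le> 1\<close>] on[OF i(2) \<open>x \<le> 1\<close>]] by simp
  also have "\<dots> \<le> integral {0..1} (\<lambda>t. \<bar>f t - g t\<bar>)"
    by (rule integral_subset_le) (use \<open>x \<le> 1\<close> on[OF i(2)] in auto)
  also have "\<dots> = (LINT t|I01. \<bar>f t - g t\<bar>)" by (rule I01_integral[OF i(2), symmetric])
  finally show ?thesis .
qed

text \<open>
  For a continuous integrand this is the fundamental theorem of calculus for the product of
  \<open>G (primitive f x)\<close> and \<open>\<phi> x\<close>, which vanishes at both end points.
\<close>

lemma chain_rule_primitive_continuous:
  assumes f: "continuous_on {0..1} f"
    and G: "\<And>t. (G has_real_derivative G' t) (at t)" "continuous_on UNIV G'"
    and \<phi>: "test_fun \<phi>"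
  shows "(LINT x|I01. G' (primitive f x) * f x * \<phi> x) = - (LINT x|I01. G (primitive f x) * deriv \<phi> x)"
proof -
  let ?F = "primitive f"
  have F: "continuous_on {0..1} ?F"
    by (rule continuous_on_primitive[OF integrable_I01_continuous[OF f]])
  have GF: "continuous_on {0..1} (\<lambda>x. G (?F x))" "continuous_on {0..1} (\<lambda>x. G' (?F x))"
    using continuous_on_compose2[OF DERIV_continuous_on[of UNIV G G'] F]
      continuous_on_compose2[OF G(2) F] G(1) by auto
  have s: "continuous_on {0..1} \<phi>" "continuous_on {0..1} (deriv \<phi>)"
    by (intro continuous_on_smooth smooth_deriv test_fun_smooth \<phi>)+
  let ?a = "\<lambda>x. G' (?F x) * f x * \<phi> x" and ?b = "\<lambda>x. G (?F x) * deriv \<phi> x"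
  have c: "continuous_on {0..1} ?a" "continuous_on {0..1} ?b"
    by (intro continuous_intros GF f s)+
  have "(LINT x|I01. ?a x + ?b x) = G (?F 1) * \<phi> 1 - G (?F 0) * \<phi> 0"
  proof (rule I01_FTC)
    fix x :: real assume x: "0 \<le> x" "x \<le> 1"
    have "((\<lambda>x. G (?F x)) has_real_derivative G' (?F x) * f x) (at x within {0..1})"
      by (rule DERIV_chain2[OF G(1) primitive_has_derivative[OF f x]])
    then have "((\<lambda>x. G (?F x) * \<phi> x) has_real_derivative G' (?F x) * f x * \<phi> x + deriv \<phi> x * G (?F x)) (at x within {0..1})"
      by (rule DERIV_mult[OF _ has_field_derivative_at_within[OF smooth_has_deriv[OF test_fun_smooth[OF \<phi>]]]])
    then show "((\<lambda>x. G (?F x) * \<phi> x) has_real_derivative ?a x + ?b x) (at x within {0..1})"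
      by (simp add: mult.commute)
  qed (intro continuous_intros c)
  also have "\<dots> = 0" using test_fun_eq_0[OF \<phi>] by simp
  finally show ?thesis
    using Bochner_Integration.integral_add[OF c[THEN integrable_I01_continuous]] by simp
qed

text \<open>
  The function \<open>G (primitive f x)\<close> has the weak derivative \<open>G' (primitive f x) * f x\<close> for every
  integrable \<open>f\<close>. Both sides of the identity are continuous in \<open>f\<close> with respect to the \<open>L\<^sub>1\<close> norm, since
  \<open>L\<^sub>1\<close> convergence of integrands is uniform convergence of primitives, so the continuous case suffices.
  This replaces differentiating the primitive almost everywhere.
\<close>

theorem chain_rule_primitive:
  assumes f: "integrable I01 f"
    and G: "\<And>t. (G has_real_derivative G' t) (at t)" "continuous_on UNIV G'"
    and \<phi>: "test_fun \<phi>"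
  shows "(LINT x|I01. G' (primitive f x) * f x * \<phi> x) = - (LINT x|I01. G (primitive f x) * deriv \<phi> x)"
proof -
  have "\<exists>h. continuous_on UNIV h \<and> (LINT x|I01. \<bar>h x - f x\<bar>) < 1 / real (Suc k)" for k
    using continuous_L1_dense[OF f, of "1 / real (Suc k)"] by auto
  then obtain h where h: "\<And>k. continuous_on UNIV (h k)"
    and hf: "\<And>k. (LINT x|I01. \<bar>h k x - f x\<bar>) < 1 / real (Suc k)" by metis
  have hc: "continuous_on {0..1} (h k)" for k using h continuous_on_subset by blast
  note ih = hc[THEN integrable_I01_continuous]
  let ?F = "primitive f" and ?H = "\<lambda>k. primitive (h k)"
  have F: "continuous_on {0..1} ?F" and H: "continuous_on {0..1} (?H k)" for k
    by (intro continuous_on_primitive f ih)+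
  have HF: "\<bar>?H k x - ?F x\<bar> \<le> 1 / real (Suc k)" if "0 \<le> x" "x \<le> 1" for k x
    using primitive_diff_le[OF ih f that] hf[of k] by (rule order_trans[OF _ less_imp_le])
  have lim: "(\<lambda>k. ?H k x) \<longlonglongrightarrow> ?F x" if "0 < x" "x < 1" for x
  proof (rule LIM_zero_cancel, rule Lim_null_comparison)
    show "\<forall>\<^sub>F k in sequentially. norm (?H k x - ?F x) \<le> 1 / real (Suc k)"
      using HF that by simp
    show "(\<lambda>k. 1 / real (Suc k)) \<longlonglongrightarrow> 0" by (rule LIMSEQ_Suc[OF lim_const_over_n])
  qed
  have Gc: "continuous_on UNIV G" using G(1) by (intro DERIV_continuous_on) auto
  obtain R where R: "\<And>x. 0 \<le> x \<Longrightarrow> x \<le> 1 \<Longrightarrow> \<bar>?F x\<bar> \<le> R"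
    using continuous_on_I01_bounded[OF F] by blast
  \<comment> \<open>Uniform bounds on the primitives confine the arguments of \<open>G\<close> and \<open>G'\<close> to a compact interval.\<close>
  have HR: "?H k x \<in> {- (R + 1)..R + 1}" if "0 \<le> x" "x \<le> 1" for k x
  proof -
    have "1 / real (Suc k) \<le> 1" by simp
    then show ?thesis using R[OF that] HF[OF that, of k] by (simp only: atLeastAtMost_iff abs_le_iff) linarith
  qed
  obtain C where C: "\<And>t. t \<in> {- (R + 1)..R + 1} \<Longrightarrow> \<bar>G t\<bar> \<le> C"
    using continuous_on_I01_bounded[OF continuous_on_subset[OF Gc]] by (metis atLeastAtMost_iff top_greatest)
  obtain C' where C': "\<And>t. t \<in> {- (R + 1)..R + 1} \<Longrightarrow> \<bar>G' t\<bar> \<le> C'" "0 \<le> C'"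
    using continuous_on_I01_bounded[OF continuous_on_subset[OF G(2)]] by (metis atLeastAtMost_iff top_greatest)
  have s: "continuous_on {0..1} \<phi>" "continuous_on {0..1} (deriv \<phi>)"
    by (intro continuous_on_smooth smooth_deriv test_fun_smooth \<phi>)+
  obtain B where B: "\<And>x. 0 \<le> x \<Longrightarrow> x \<le> 1 \<Longrightarrow> \<bar>\<phi> x\<bar> \<le> B" "0 \<le> B"
    using continuous_on_I01_bounded[OF s(1)] by blast
  have cG: "continuous_on {0..1} (\<lambda>x. G (?F x))" "continuous_on {0..1} (\<lambda>x. G (?H k x))"
      "continuous_on {0..1} (\<lambda>x. G' (?F x))" "continuous_on {0..1} (\<lambda>x. G' (?H k x))" for k
    by (rule continuous_on_compose2[OF Gc] continuous_on_compose2[OF G(2)], rule F H, simp)+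
  note [measurable] = cG[THEN measurable_I01_continuous] s[THEN measurable_I01_continuous]
    borel_measurable_integrable[OF f] borel_measurable_integrable[OF ih]
  have r: "(\<lambda>k. LINT x|I01. G (?H k x) * deriv \<phi> x) \<longlonglongrightarrow> (LINT x|I01. G (?F x) * deriv \<phi> x)"
  proof (rule integral_dominated_convergence)
    show "integrable I01 (\<lambda>x. C * \<bar>deriv \<phi> x\<bar>)"
      using integrable_I01_continuous[OF s(2)] by simp
    show "AE x in I01. (\<lambda>k. G (?H k x) * deriv \<phi> x) \<longlonglongrightarrow> G (?F x) * deriv \<phi> x"
      using Gc by (intro AE_I01I tendsto_intros isCont_tendsto_compose[OF _ lim])
        (auto simp: continuous_on_eq_continuous_at)
    show "AE x in I01. norm (G (?H k x) * deriv \<phi> x) \<le> C * \<bar>deriv \<phi> x\<bar>" for k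
      by (intro AE_I01I) (auto simp: abs_mult simp del: atLeastAtMost_iff intro!: mult_right_mono C HR)
  qed measurable
  \<comment> \<open>The left-hand side needs two steps: first the limit in the argument of \<open>G'\<close> only, with \<open>f\<close> fixed.\<close>
  have l1: "(\<lambda>k. LINT x|I01. G' (?H k x) * f x * \<phi> x) \<longlonglongrightarrow> (LINT x|I01. G' (?F x) * f x * \<phi> x)"
  proof (rule integral_dominated_convergence)
    show "integrable I01 (\<lambda>x. C' * \<bar>f x * \<phi> x\<bar>)"
      using integrable_mult_continuous[OF f s(1)] by simp
    show "AE x in I01. (\<lambda>k. G' (?H k x) * f x * \<phi> x) \<longlonglongrightarrow> G' (?F x) * f x * \<phi> x"
      using G(2) by (intro AE_I01I tendsto_intros isCont_tendsto_compose[OF _ lim])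
        (auto simp: continuous_on_eq_continuous_at)
    show "AE x in I01. norm (G' (?H k x) * f x * \<phi> x) \<le> C' * \<bar>f x * \<phi> x\<bar>" for k
      by (intro AE_I01I)
        (auto simp: abs_mult mult.assoc simp del: atLeastAtMost_iff intro!: mult_right_mono C' HR)
  qed measurable
  have i2: "integrable I01 (\<lambda>x. G' (?H k x) * f x * \<phi> x)" "integrable I01 (\<lambda>x. G' (?H k x) * h k x * \<phi> x)" for k
    using integrable_mult_continuous[OF integrable_mult_continuous[OF f cG(4)] s(1)]
      integrable_mult_continuous[OF integrable_mult_continuous[OF ih cG(4)] s(1)]
    by (simp_all add: mult.commute)
  \<comment> \<open>Then replacing \<open>f\<close> by \<open>h k\<close> costs a multiple of their \<open>L\<^sub>1\<close> distance.\<close>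
  have l2: "(\<lambda>k. (LINT x|I01. G' (?H k x) * h k x * \<phi> x) - (LINT x|I01. G' (?H k x) * f x * \<phi> x)) \<longlonglongrightarrow> 0"
  proof (rule Lim_null_comparison)
    have "norm ((LINT x|I01. G' (?H k x) * h k x * \<phi> x) - (LINT x|I01. G' (?H k x) * f x * \<phi> x)) \<le> C' * B * (1 / real (Suc k))" for k
    proof -
      have i: "integrable I01 (\<lambda>x. \<bar>h k x - f x\<bar>)" using ih f by simp
      have "(LINT x|I01. G' (?H k x) * h k x * \<phi> x) - (LINT x|I01. G' (?H k x) * f x * \<phi> x)
        = (LINT x|I01. G' (?H k x) * h k x * \<phi> x - G' (?H k x) * f x * \<phi> x)"
        by (rule Bochner_Integration.integral_diff[symmetric]) (rule i2)+
      also have "norm \<dots> \<le> (LINT x|I01. C' * B * \<bar>h k x - f x\<bar>)"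
      proof (rule Bochner_Integration.integral_norm_bound_integral)
        show "integrable I01 (\<lambda>x. C' * B * \<bar>h k x - f x\<bar>)" using i by simp
        fix x assume "x \<in> space I01"
        then have x: "0 \<le> x" "x \<le> 1" by auto
        have "norm (G' (?H k x) * h k x * \<phi> x - G' (?H k x) * f x * \<phi> x)
          = \<bar>G' (?H k x)\<bar> * \<bar>\<phi> x\<bar> * \<bar>h k x - f x\<bar>"
          by (simp add: abs_mult[symmetric] algebra_simps)
        also have "\<dots> \<le> C' * B * \<bar>h k x - f x\<bar>"
          by (intro mult_right_mono mult_mono C' HR B x) auto
        finally show "norm (G' (?H k x) * h k x * \<phi> x - G' (?H k x) * f x * \<phi> x) \<le> C' * B * \<bar>h k x - f x\<bar>" .
      qed (intro Bochner_Integration.integrable_diff i2)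
      also have "\<dots> = C' * B * (LINT x|I01. \<bar>h k x - f x\<bar>)" by simp
      also have "\<dots> \<le> C' * B * (1 / real (Suc k))"
        using hf[of k] B(2) C'(2) by (intro mult_left_mono) auto
      finally show ?thesis .
    qed
    then show "\<forall>\<^sub>F k in sequentially. norm ((LINT x|I01. G' (?H k x) * h k x * \<phi> x) - (LINT x|I01. G' (?H k x) * f x * \<phi> x)) \<le> C' * B * (1 / real (Suc k))"
      by simp
    show "(\<lambda>k. C' * B * (1 / real (Suc k))) \<longlonglongrightarrow> 0"
      using tendsto_mult_right_zero[OF LIMSEQ_Suc[OF lim_const_over_n]] .
  qed
  have "(\<lambda>k. LINT x|I01. G' (?H k x) * h k x * \<phi> x) \<longlonglongrightarrow> (LINT x|I01. G' (?F x) * f x * \<phi> x)"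
    using tendsto_add[OF l2 l1] by simp
  moreover have "(\<lambda>k. LINT x|I01. G' (?H k x) * h k x * \<phi> x) \<longlonglongrightarrow> - (LINT x|I01. G (?F x) * deriv \<phi> x)"
    unfolding chain_rule_primitive_continuous[OF hc G \<phi>] by (rule tendsto_minus[OF r])
  ultimately show ?thesis by (rule LIMSEQ_unique)
qed

corollary primitive_by_parts:
  assumes "integrable I01 f" "test_fun \<phi>"
  shows "(LINT x|I01. f x * \<phi> x) = - (LINT x|I01. primitive f x * deriv \<phi> x)"
  using chain_rule_primitive[OF assms(1), of "\<lambda>t. t" "\<lambda>t. 1"] assms(2) by simp

text \<open>
  A primitive has derivative \<open>0\<close> almost everywhere on each of its level sets. To see it weakly,
  flatten the primitive: the functions \<open>arctan (n * (t - c)) / n\<close> tend to \<open>0\<close> uniformly, while their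
  derivatives \<open>1 / (1 + (n * (t - c))\<^sup>2)\<close> tend boundedly to the indicator of \<open>{c}\<close>. In the limit of the
  chain rule, \<open>f\<close> restricted to the level set is orthogonal to all test functions.
\<close>

theorem zero_on_level_set_of_primitive:
  assumes f: "integrable I01 f"
  shows "AE x in I01. primitive f x = c \<longrightarrow> f x = 0"
proof -
  let ?F = "primitive f"
  have cF: "continuous_on {0..1} ?F" by (rule continuous_on_primitive[OF f])
  have [measurable]: "f \<in> borel_measurable I01" "?F \<in> borel_measurable I01"
    using f measurable_I01_continuous[OF cF] by simp_all
  define D where "D n t = 1 / (1 + (real (Suc n) * (t - c))\<^sup>2)" for n t
  define G where "G n t = arctan (real (Suc n) * (t - c)) / real (Suc n)" for n t
  have pos: "1 + (y::real)\<^sup>2 > 0" for y by (simp add: add_pos_nonneg)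
  have G: "(G n has_real_derivative D n t) (at t)" for n t
    unfolding G_def D_def
    by (rule derivative_eq_intros | simp)+ (simp add: divide_simps)
  have D: "continuous_on UNIV (D n)" for n
    unfolding D_def by (intro continuous_intros) (use pos in \<open>auto simp: less_imp_neq[symmetric]\<close>)
  have [measurable]: "(\<lambda>x. D n (?F x)) \<in> borel_measurable I01" "(\<lambda>x. G n (?F x)) \<in> borel_measurable I01" for n
    unfolding D_def G_def by measurable
  define fE where "fE x = (if ?F x = c then f x else 0)" for x
  have [measurable]: "fE \<in> borel_measurable I01" unfolding fE_def by measurable
  have "AE x in I01. fE x = 0"
  proof (rule fundamental_lemma)
    show "integrable I01 fE"
      by (rule Bochner_Integration.integrable_bound[OF f]) (auto simp: fE_def)
    fix \<phi> assume \<phi>: "test_fun \<phi>"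
    have s: "continuous_on {0..1} \<phi>" "continuous_on {0..1} (deriv \<phi>)"
      by (intro continuous_on_smooth smooth_deriv test_fun_smooth \<phi>)+
    note [measurable] = s[THEN measurable_I01_continuous]
    have "(\<lambda>n. LINT x|I01. D n (?F x) * f x * \<phi> x) \<longlonglongrightarrow> (LINT x|I01. fE x * \<phi> x)"
    proof (rule integral_dominated_convergence)
      show "integrable I01 (\<lambda>x. \<bar>f x * \<phi> x\<bar>)"
        using integrable_mult_continuous[OF f s(1)] by simp
      have "(\<lambda>n. D n t) \<longlonglongrightarrow> (if t = c then 1 else 0)" for t
      proof (cases "t = c")
        case False
        have "filterlim (\<lambda>n. \<bar>t - c\<bar> * real (Suc n)) at_top sequentially"
          using False by (intro filterlim_tendsto_pos_mult_at_top[OF tendsto_const])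
            (auto simp del: of_nat_Suc intro: filterlim_compose[OF filterlim_real_sequentially filterlim_Suc])
        then have "filterlim (\<lambda>n. 1 + (\<bar>t - c\<bar> * real (Suc n))\<^sup>2) at_top sequentially"
          by (intro filterlim_tendsto_add_at_top[OF tendsto_const] filterlim_pow_at_top) auto
        then have "(\<lambda>n. inverse (1 + (\<bar>t - c\<bar> * real (Suc n))\<^sup>2)) \<longlonglongrightarrow> 0"
          by (rule tendsto_inverse_0_at_top)
        moreover have "inverse (1 + (\<bar>t - c\<bar> * real (Suc n))\<^sup>2) = D n t" for n
          by (simp add: D_def power_mult_distrib inverse_eq_divide mult.commute)
        ultimately show ?thesis using False by simp
      qed (simp add: D_def)
      then have "(\<lambda>n. D n (?F x) * f x * \<phi> x) \<longlonglongrightarrow> (if ?F x = c then 1 else 0) * f x * \<phi> x" for x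
        by (intro tendsto_intros)
      moreover have "(if ?F x = c then 1 else 0) * f x * \<phi> x = fE x * \<phi> x" for x
        by (simp add: fE_def)
      ultimately show "AE x in I01. (\<lambda>n. D n (?F x) * f x * \<phi> x) \<longlonglongrightarrow> fE x * \<phi> x" by simp
      have "\<bar>D n t\<bar> \<le> 1" for n t using pos[of "real (Suc n) * (t - c)"] by (simp add: D_def)
      then have "\<bar>D n t\<bar> * (\<bar>f x\<bar> * \<bar>\<phi> x\<bar>) \<le> \<bar>f x\<bar> * \<bar>\<phi> x\<bar>" for n t x
        by (intro mult_left_le_one_le) auto
      then show "AE x in I01. norm (D n (?F x) * f x * \<phi> x) \<le> \<bar>f x * \<phi> x\<bar>" for n
        by (intro AE_I2) (simp add: abs_mult mult.assoc)
    qed measurable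
    moreover have "(\<lambda>n. LINT x|I01. G n (?F x) * deriv \<phi> x) \<longlonglongrightarrow> (LINT x|I01. 0)"
    proof (rule integral_dominated_convergence)
      have G2: "\<bar>G n t\<bar> \<le> 2 / real (Suc n)" for n t
      proof -
        have "\<bar>arctan (real (Suc n) * (t - c))\<bar> \<le> 2"
          using arctan_bounded[of "real (Suc n) * (t - c)"] pi_less_4 by (simp add: abs_le_iff)
        then show ?thesis by (simp add: G_def divide_right_mono)
      qed
      show "integrable I01 (\<lambda>x. 2 * \<bar>deriv \<phi> x\<bar>)"
        using integrable_I01_continuous[OF s(2)] by simp
      have "(\<lambda>n. G n t) \<longlonglongrightarrow> 0" for t
        by (rule Lim_null_comparison[OF _ LIMSEQ_Suc[OF lim_const_over_n[of 2]]]) (use G2 in simp)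
      then show "AE x in I01. (\<lambda>n. G n (?F x) * deriv \<phi> x) \<longlonglongrightarrow> 0"
        by (intro AE_I2 tendsto_mult_left_zero)
      have "\<bar>G n t\<bar> \<le> 2" for n t
        by (rule order_trans[OF G2]) (simp add: divide_simps)
      then show "AE x in I01. norm (G n (?F x) * deriv \<phi> x) \<le> 2 * \<bar>deriv \<phi> x\<bar>" for n
        by (intro AE_I2) (auto simp: abs_mult intro!: mult_right_mono)
    qed measurable
    then have "(\<lambda>n. LINT x|I01. D n (?F x) * f x * \<phi> x) \<longlonglongrightarrow> - 0"
      unfolding chain_rule_primitive[OF f G D \<phi>] by (intro tendsto_minus) simp
    ultimately show "(LINT x|I01. fE x * \<phi> x) = 0" using LIMSEQ_unique by fastforce
  qed
  then show ?thesis by eventually_elim (simp add: fE_def split: if_splits)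
qed

section \<open>Weak derivatives and the space $H^1_0$\<close>

lemma weak_deriv_integrable:
  assumes "has_weak_deriv u g"
  shows "integrable I01 u" "integrable I01 g"
  using assms Lp_2_integrable by (auto simp: has_weak_deriv_def)

lemma test_times_integrable:
  assumes "integrable I01 g" "test_fun \<phi>"
  shows "integrable I01 (\<lambda>x. g x * \<phi> x)" "integrable I01 (\<lambda>x. g x * deriv \<phi> x)"
  by (intro integrable_mult_continuous assms continuous_on_smooth smooth_deriv test_fun_smooth)+

text \<open>
  By the fundamental lemma, null sets are the only freedom in a weak derivative.
\<close>

lemma has_weak_deriv_AE_unique:
  assumes "has_weak_deriv u g" "has_weak_deriv v h" "AE x in I01. u x = v x"
  shows "AE x in I01. g x = h x"
proof -
  note i = weak_deriv_integrable[OF assms(1)] weak_deriv_integrable[OF assms(2)]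
  have "AE x in I01. g x - h x = 0"
  proof (rule fundamental_lemma)
    show "integrable I01 (\<lambda>x. g x - h x)" using i by simp
    fix \<phi> assume \<phi>: "test_fun \<phi>"
    have "(LINT x|I01. u x * deriv \<phi> x) = (LINT x|I01. v x * deriv \<phi> x)"
      by (rule integral_cong_AE)
        (use assms(3) test_times_integrable[OF _ \<phi>] i in \<open>auto intro: borel_measurable_integrable\<close>)
    moreover have "(LINT x|I01. u x * deriv \<phi> x) = - (LINT x|I01. g x * \<phi> x)"
      "(LINT x|I01. v x * deriv \<phi> x) = - (LINT x|I01. h x * \<phi> x)"
      using assms \<phi> by (auto simp: has_weak_deriv_def)
    moreover have "(LINT x|I01. (g x - h x) * \<phi> x) = (LINT x|I01. g x * \<phi> x) - (LINT x|I01. h x * \<phi> x)"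
      using test_times_integrable[OF _ \<phi>] i by (simp add: left_diff_distrib)
    ultimately show "(LINT x|I01. (g x - h x) * \<phi> x) = 0" by simp
  qed
  then show ?thesis by simp
qed

lemma has_weak_deriv_weak_deriv: "u \<in> H1 \<Longrightarrow> has_weak_deriv u (weak_deriv u)"
  unfolding H1_def weak_deriv_def mem_Collect_eq by (rule someI_ex[of "has_weak_deriv u"])

lemma weak_deriv_AE:
  assumes "has_weak_deriv u g"
  shows "AE x in I01. weak_deriv u x = g x"
proof -
  have "u \<in> H1" using assms by (auto simp: H1_def)
  then show ?thesis
    by (intro has_weak_deriv_AE_unique[OF has_weak_deriv_weak_deriv assms]) auto
qed

lemma has_weak_deriv_diff:
  assumes u: "has_weak_deriv u g" and v: "has_weak_deriv v h"
  shows "has_weak_deriv (\<lambda>x. u x - v x) (\<lambda>x. g x - h x)"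
proof -
  note i = weak_deriv_integrable[OF u] weak_deriv_integrable[OF v]
  have "(LINT x|I01. (u x - v x) * deriv \<phi> x) = - (LINT x|I01. (g x - h x) * \<phi> x)" if \<phi>: "test_fun \<phi>" for \<phi>
    using u v \<phi> test_times_integrable[OF _ \<phi>] i by (simp add: has_weak_deriv_def left_diff_distrib)
  then show ?thesis using u v by (auto simp: has_weak_deriv_def intro: Lp_2_diff)
qed

lemma has_weak_deriv_test_fun:
  assumes u: "test_fun u"
  shows "has_weak_deriv u (deriv u)"
proof -
  have s: "smooth u" "smooth (deriv u)" by (intro smooth_deriv test_fun_smooth u)+
  have "(LINT x|I01. u x * deriv \<phi> x) = - (LINT x|I01. deriv u x * \<phi> x)" if \<phi>: "test_fun \<phi>" for \<phi>
  proof -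
    have s': "smooth \<phi>" "smooth (deriv \<phi>)" by (intro smooth_deriv test_fun_smooth \<phi>)+
    have "(LINT x|I01. deriv u x * \<phi> x + deriv \<phi> x * u x) = u 1 * \<phi> 1 - u 0 * \<phi> 0"
    proof (rule I01_FTC)
      show "((\<lambda>x. u x * \<phi> x) has_real_derivative deriv u x * \<phi> x + deriv \<phi> x * u x) (at x within {0..1})" for x
        by (rule DERIV_mult) (rule has_field_derivative_at_within, rule smooth_has_deriv, rule s s')+
    qed (intro continuous_on_add continuous_on_mult continuous_on_smooth s s')
    moreover have "integrable I01 (\<lambda>x. deriv u x * \<phi> x)" "integrable I01 (\<lambda>x. deriv \<phi> x * u x)"
      by (intro integrable_I01_continuous continuous_on_mult continuous_on_smooth s s')+
    ultimately show ?thesis using test_fun_eq_0[OF u] by (simp add: mult.commute)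
  qed
  then show ?thesis using s by (simp add: has_weak_deriv_def Lp_2_continuous continuous_on_smooth)
qed

text \<open>
  Convergence in \<open>H\<^sup>1\<close> enters the argument only through \<open>L\<^sub>1\<close> convergence of derivatives.
\<close>

lemma H1_norm_ge:
  assumes "has_weak_deriv u g"
  shows "(LINT x|I01. \<bar>g x\<bar>) \<le> H1_norm u"
proof -
  have "u \<in> H1" using assms by (auto simp: H1_def)
  then have w: "has_weak_deriv u (weak_deriv u)" by (rule has_weak_deriv_weak_deriv)
  have "(LINT x|I01. \<bar>g x\<bar>) = (LINT x|I01. \<bar>weak_deriv u x\<bar>)"
    by (rule integral_cong_AE)
      (use weak_deriv_AE[OF assms] weak_deriv_integrable(2)[OF assms] weak_deriv_integrable(2)[OF w] in auto)
  also have "\<dots> \<le> Lp_norm 2 (weak_deriv u)"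
    using w by (intro L1_le_L2) (simp add: has_weak_deriv_def)
  also have "\<dots> \<le> H1_norm u" by (simp add: H1_norm_def real_le_rsqrt)
  finally show ?thesis .
qed

lemma H1_norm_AE_zero:
  assumes "AE x in I01. u x = 0" "u \<in> borel_measurable I01"
  shows "H1_norm u = 0"
proof -
  have "Lp_norm 2 v = 0" if "AE x in I01. v x = 0" for v
    using that by (simp add: Lp_norm_2 integral_eq_zero_AE)
  moreover have "AE x in I01. weak_deriv u x = 0"
  proof (rule weak_deriv_AE)
    have z: "integrable I01 v" "(LINT x|I01. v x * w x) = 0" if "AE x in I01. v x = 0" "v \<in> borel_measurable I01" for v w :: "real \<Rightarrow> real"
    proof -
      show "integrable I01 v" using that integrable_cong_AE[of v I01 "\<lambda>x. 0"] by simp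
      show "(LINT x|I01. v x * w x) = 0"
        by (rule integral_eq_zero_AE) (use that in auto)
    qed
    show "has_weak_deriv u (\<lambda>x. 0)"
      using z(2)[OF assms] z(1)[of "\<lambda>x. (u x)\<^sup>2"] assms
      by (auto simp: has_weak_deriv_def Lp_2_iff)
  qed
  ultimately show ?thesis using assms(1) by (simp add: H1_norm_def)
qed

lemma test_fun_H10: "test_fun \<phi> \<Longrightarrow> \<phi> \<in> H10"
  using has_weak_deriv_test_fun H1_norm_AE_zero[of "\<lambda>x. 0"]
  by (auto simp: H10_def H1_def intro!: exI[of _ "\<lambda>n. \<phi>"])

lemma H10_weak_deriv: "u \<in> H10 \<Longrightarrow> has_weak_deriv u (weak_deriv u)"
  by (intro has_weak_deriv_weak_deriv) (simp add: H10_def)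

text \<open>
  The boundary values in integrated form: the derivative of a test function integrates to \<open>0\<close>, and
  this passes to limits in \<open>H\<^sup>1\<close>.
\<close>

lemma H10_weak_deriv_mean_zero:
  assumes "u \<in> H10"
  shows "(LINT x|I01. weak_deriv u x) = 0"
proof -
  obtain \<phi> where \<phi>: "\<And>n. test_fun (\<phi> n)" and lim: "(\<lambda>n. H1_norm (\<lambda>x. u x - \<phi> n x)) \<longlonglongrightarrow> 0"
    using assms by (auto simp: H10_def)
  have "\<bar>LINT x|I01. weak_deriv u x\<bar> \<le> H1_norm (\<lambda>x. u x - \<phi> n x)" for n
  proof -
    have s: "continuous_on {0..1} (deriv (\<phi> n))"
      by (intro continuous_on_smooth smooth_deriv test_fun_smooth \<phi>)
    have "(LINT x|I01. deriv (\<phi> n) x) = \<phi> n 1 - \<phi> n 0"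
      by (rule I01_FTC[OF has_field_derivative_at_within s])
        (intro smooth_has_deriv test_fun_smooth \<phi>)
    then have "(LINT x|I01. weak_deriv u x) = (LINT x|I01. weak_deriv u x - deriv (\<phi> n) x)"
      using test_fun_eq_0[OF \<phi>[of n]] weak_deriv_integrable(2)[OF H10_weak_deriv[OF assms]]
        integrable_I01_continuous[OF s] by simp
    also have "\<bar>\<dots>\<bar> \<le> (LINT x|I01. \<bar>weak_deriv u x - deriv (\<phi> n) x\<bar>)"
      by (rule integral_abs_bound)
    also have "\<dots> \<le> H1_norm (\<lambda>x. u x - \<phi> n x)"
      by (intro H1_norm_ge has_weak_deriv_diff H10_weak_deriv assms has_weak_deriv_test_fun \<phi>)
    finally show ?thesis .
  qed
  then have "\<bar>LINT x|I01. weak_deriv u x\<bar> \<le> 0"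
    by (intro LIMSEQ_le_const[OF lim]) blast
  then show ?thesis by simp
qed

section \<open>The flux and its constant of integration\<close>

lemma admissibleD:
  assumes "a \<in> admissible l L"
  shows "a \<in> borel_measurable I01" "AE x in I01. l \<le> a x" "AE x in I01. a x \<le> L"
  using assms by (auto simp: admissible_def Linf_def)

text \<open>
  In one dimension the equation integrates: testing with \<open>\<phi>\<close> says that \<open>a u' + primitive f\<close> is
  orthogonal to every \<open>\<phi>'\<close>, so it is a constant.
\<close>

lemma weak_solution_flux:
  assumes f: "integrable I01 f" and a: "a \<in> borel_measurable I01" "AE x in I01. \<bar>a x\<bar> \<le> C"
    and u: "weak_solution f a u"
  obtains c where "AE x in I01. a x * weak_deriv u x = c - primitive f x"
proof -
  let ?g = "weak_deriv u" and ?F = "primitive f"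
  have "u \<in> H10" using u by (simp add: weak_solution_def)
  then have ig: "integrable I01 ?g" by (intro weak_deriv_integrable(2)[OF H10_weak_deriv])
  have iF: "integrable I01 ?F"
    by (intro integrable_I01_continuous continuous_on_primitive f)
  have iag: "integrable I01 (\<lambda>x. a x * ?g x)"
    using integrable_mult_bounded[OF ig a] by (simp add: mult.commute)
  obtain c where "AE x in I01. a x * ?g x + ?F x = c"
  proof (rule du_Bois_Reymond)
    show "integrable I01 (\<lambda>x. a x * ?g x + ?F x)" using iag iF by simp
    fix \<phi> assume \<phi>: "test_fun \<phi>"
    note w\<phi> = has_weak_deriv_test_fun[OF \<phi>]
    have "(LINT x|I01. a x * ?g x * deriv \<phi> x) = (LINT x|I01. a x * ?g x * weak_deriv \<phi> x)"
    proof (rule integral_cong_AE)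
      show "(\<lambda>x. a x * ?g x * deriv \<phi> x) \<in> borel_measurable I01"
        using test_times_integrable(2)[OF iag \<phi>] by simp
      show "(\<lambda>x. a x * ?g x * weak_deriv \<phi> x) \<in> borel_measurable I01"
        by (intro borel_measurable_times[OF borel_measurable_integrable[OF iag]]
            borel_measurable_integrable weak_deriv_integrable(2)[OF H10_weak_deriv] test_fun_H10 \<phi>)
      show "AE x in I01. a x * ?g x * deriv \<phi> x = a x * ?g x * weak_deriv \<phi> x"
        using weak_deriv_AE[OF w\<phi>] by eventually_elim simp
    qed
    also have "\<dots> = (LINT x|I01. f x * \<phi> x)"
      using u test_fun_H10[OF \<phi>] by (auto simp: weak_solution_def)
    also have "\<dots> = - (LINT x|I01. ?F x * deriv \<phi> x)"
      by (rule primitive_by_parts[OF f \<phi>])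
    finally show "(LINT x|I01. (a x * ?g x + ?F x) * deriv \<phi> x) = 0"
      using test_times_integrable(2)[OF iag \<phi>] test_times_integrable(2)[OF iF \<phi>]
      by (simp add: distrib_right)
  qed
  then have "AE x in I01. a x * ?g x = c - ?F x" by eventually_elim simp
  then show thesis by (rule that)
qed

text \<open>
  If the continuous function \<open>c - F\<close> had no zero, it would have a strict sign, and so would \<open>g\<close>,
  against the vanishing mean of \<open>g\<close>.
\<close>

lemma flux_vanishes_somewhere:
  assumes g: "integrable I01 g" "(LINT x|I01. g x) = 0"
    and a: "AE x in I01. 0 < a x"
    and flux: "AE x in I01. a x * g x = c - F x"
    and F: "continuous_on {0..1} F"
  obtains x0 where "0 \<le> x0" "x0 \<le> 1" "F x0 = (c :: real)"
proof (rule ccontr)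
  assume "\<not> thesis"
  then have ne: "\<And>x. 0 \<le> x \<Longrightarrow> x \<le> 1 \<Longrightarrow> F x \<noteq> c" using that by blast
  have sign: "\<not> (\<forall>x. 0 \<le> x \<and> x \<le> 1 \<longrightarrow> s * (c - F x) > 0)" for s :: real
  proof
    assume s: "\<forall>x. 0 \<le> x \<and> x \<le> 1 \<longrightarrow> s * (c - F x) > 0"
    have pos: "AE x in I01. 0 < s * g x"
      using flux a AE_space
    proof eventually_elim
      case (elim x)
      then have "0 < s * (a x * g x)" using s by simp
      then have "0 < a x * (s * g x)" by (simp add: mult.left_commute)
      then show ?case using elim by (simp add: zero_less_mult_iff)
    qed
    have "(LINT x|I01. s * g x) = 0" using g by simp
    moreover have "integrable I01 (\<lambda>x. s * g x)" using g by simp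
    moreover have "AE x in I01. 0 \<le> s * g x" using pos by eventually_elim simp
    ultimately have "AE x in I01. s * g x = 0" using integral_nonneg_eq_0_iff_AE by blast
    with pos have "AE x in I01. False" by eventually_elim simp
    then show False using AE_I01_not_False by blast
  qed
  from sign[of 1] obtain y where y: "0 \<le> y" "y \<le> 1" "c < F y"
    using ne by (auto simp: not_less le_less)
  from sign[of "- 1"] obtain z where z: "0 \<le> z" "z \<le> 1" "F z < c"
    using ne by (auto simp: not_less le_less)
  have "connected (F ` {0..1})"
    by (intro connected_continuous_image F connected_Icc)
  then have "c \<in> F ` {0..1}"
    by (rule connectedD_interval[of _ "F z" "F y"]) (use y z in auto)
  then obtain x where "0 \<le> x" "x \<le> 1" "F x = c" by auto
  then show False using ne by blast
qed

text \<open>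
  Near the zero \<open>x0\<close> of \<open>F - c0\<close> the first term of the bound is small. Averaging the bound against a
  continuous bump \<open>W\<close> that lives where \<open>\<bar>F - c0\<bar> \<le> d\<close> gives \<open>\<bar>c n - c0\<bar> \<le> K * d\<close> up to an error that
  tends to \<open>0\<close> with the integral of \<open>e n\<close>.
\<close>

lemma constants_converge:
  fixes F :: "real \<Rightarrow> real" and c :: "nat \<Rightarrow> real"
  assumes F: "continuous_on {0..1} F" and x0: "0 \<le> x0" "x0 \<le> 1" "F x0 = c0"
    and "0 \<le> K"
    and e: "\<And>n. integrable I01 (e n)" "\<And>n x. 0 \<le> e n x" "(\<lambda>n. LINT x|I01. e n x) \<longlonglongrightarrow> 0"
    and bound: "\<And>n. AE x in I01. \<bar>c n - c0\<bar> \<le> K * \<bar>F x - c0\<bar> + e n x"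
  shows "c \<longlonglongrightarrow> c0"
proof (rule metric_LIMSEQ_I)
  fix r :: real assume "0 < r"
  \<comment> \<open>Adding \<open>1\<close> guards against \<open>K = 0\<close>.\<close>
  define d where "d = r / (2 * (K + 1))"
  have "0 < d" using \<open>0 < r\<close> \<open>0 \<le> K\<close> by (simp add: d_def)
  have Kd: "K * d < r / 2" using \<open>0 < r\<close> \<open>0 \<le> K\<close> by (simp add: d_def field_simps)
  define W where "W x = max 0 (1 - \<bar>F x - c0\<bar> / d)" for x
  have W: "continuous_on {0..1} W"
    unfolding W_def by (intro continuous_intros F) (use \<open>0 < d\<close> in auto)
  have W01: "0 \<le> W x" "W x \<le> 1" for x using \<open>0 < d\<close> by (auto simp: W_def)
  have FW: "\<bar>F x - c0\<bar> * W x \<le> d * W x" for x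
    using \<open>0 < d\<close> by (cases "\<bar>F x - c0\<bar> \<le> d") (auto simp: W_def intro: mult_right_mono)
  define I where "I = (LINT x|I01. W x)"
  have iW: "integrable I01 W" by (rule integrable_I01_continuous[OF W])
  have "I \<noteq> 0"
  proof
    assume "I = 0"
    then have "integral {0..1} W = 0" using I01_integral[OF iW] by (simp add: I_def)
    moreover have "W integrable_on {0..1}" by (rule integrable_continuous_interval[OF W])
    ultimately have "(W has_integral 0) (cbox 0 1)"
      by (metis box_real(2) has_integral_integral)
    then have "W x0 = 0"
      by (intro has_integral_0_cbox_imp_0[of 0 1 W]) (use W W01 x0 in auto)
    then show False using x0 by (simp add: W_def)
  qed
  moreover have "0 \<le> I" unfolding I_def by (rule integral_nonneg_AE) (simp add: W01)
  ultimately have "0 < I" by simp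
  have "\<forall>\<^sub>F n in sequentially. (LINT x|I01. e n x) < r / 2 * I"
    using \<open>0 < r\<close> \<open>0 < I\<close> by (intro order_tendstoD[OF e(3)]) auto
  then obtain N where N: "\<And>n. N \<le> n \<Longrightarrow> (LINT x|I01. e n x) < r / 2 * I"
    by (auto simp: eventually_sequentially)
  have "dist (c n) c0 < r" if "N \<le> n" for n
  proof -
    have "\<bar>c n - c0\<bar> * I = (LINT x|I01. \<bar>c n - c0\<bar> * W x)" by (simp add: I_def)
    also have "\<dots> \<le> (LINT x|I01. K * d * W x + e n x)"
    proof (rule integral_mono_AE)
      show "AE x in I01. \<bar>c n - c0\<bar> * W x \<le> K * d * W x + e n x"
        using bound[of n]
      proof eventually_elim
        case (elim x)
        have "\<bar>c n - c0\<bar> * W x \<le> (K * \<bar>F x - c0\<bar> + e n x) * W x"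
          by (intro mult_right_mono elim W01)
        also have "\<dots> = K * (\<bar>F x - c0\<bar> * W x) + e n x * W x" by (simp add: algebra_simps)
        also have "\<dots> \<le> K * (d * W x) + e n x * 1"
          by (intro add_mono mult_left_mono FW W01 e \<open>0 \<le> K\<close>)
        finally show ?case by (simp add: mult.assoc)
      qed
    qed (use iW e(1) in auto)
    also have "\<dots> = K * d * I + (LINT x|I01. e n x)"
      using iW e(1) by (simp add: I_def)
    also have "\<dots> < r / 2 * I + r / 2 * I"
      by (intro add_le_less_mono N that mult_right_mono) (use Kd \<open>0 < I\<close> in auto)
    finally show ?thesis using \<open>0 < I\<close> by (simp add: dist_real_def flip: distrib_right)
  qed
  then show "\<exists>N. \<forall>n\<ge>N. dist (c n) c0 < r" by blast
qed

section \<open>Removing the weight\<close>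

text \<open>
  A weight that vanishes only on a null set does not affect convergence of bounded functions: for
  every \<open>m\<close> there is the pointwise bound \<open>D n \<le> m * D n * \<bar>g\<bar> + K * max 0 (1 - m * \<bar>g\<bar>)\<close>, and the
  last term, independent of \<open>n\<close>, tends to \<open>0\<close> in mean as \<open>m\<close> grows.
\<close>

lemma weighted_L1_convergence:
  fixes D :: "nat \<Rightarrow> real \<Rightarrow> real"
  assumes D: "\<And>n. D n \<in> borel_measurable I01" "\<And>n. AE x in I01. 0 \<le> D n x \<and> D n x \<le> K"
    and g: "integrable I01 g" "AE x in I01. g x \<noteq> 0"
    and lim: "(\<lambda>n. LINT x|I01. D n x * \<bar>g x\<bar>) \<longlonglongrightarrow> 0"
  shows "(\<lambda>n. LINT x|I01. D n x) \<longlonglongrightarrow> 0"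
proof (rule metric_LIMSEQ_I)
  fix r :: real assume "0 < r"
  have [measurable]: "g \<in> borel_measurable I01" "D n \<in> borel_measurable I01" for n
    using g D by simp_all
  have bdd: "AE x in I01. \<bar>D n x\<bar> \<le> K" for n using D(2)[of n] by eventually_elim simp
  have iD: "integrable I01 (D n)" for n
    using integrable_mult_bounded[OF integrable_I01_continuous[of "\<lambda>x. 1"] D(1) bdd] by simp
  have iDg: "integrable I01 (\<lambda>x. D n x * \<bar>g x\<bar>)" for n
    using integrable_mult_bounded[OF integrable_abs[OF g(1)] D(1) bdd] by (simp add: mult.commute)
  define V where "V m x = max 0 (1 - real m * \<bar>g x\<bar>)" for m x
  have [measurable]: "V m \<in> borel_measurable I01" for m unfolding V_def by measurable
  have V01: "0 \<le> V m x" "V m x \<le> 1" for m x by (auto simp: V_def)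
  have iV: "integrable I01 (V m)" for m
    by (rule Bochner_Integration.integrable_bound[OF integrable_I01_continuous[of "\<lambda>x. 1"]])
      (use V01 in auto)
  have "(\<lambda>m. LINT x|I01. K * V m x) \<longlonglongrightarrow> (LINT x|I01. 0)"
  proof (rule integral_dominated_convergence)
    show "integrable I01 (\<lambda>x. \<bar>K\<bar>)" by (intro integrable_I01_continuous) simp
    show "AE x in I01. (\<lambda>m. K * V m x) \<longlonglongrightarrow> 0"
      using g(2)
    proof (eventually_elim, intro tendsto_eventually)
      fix x assume "g x \<noteq> 0"
      obtain N where N: "1 / \<bar>g x\<bar> \<le> real N" using real_arch_simple by blast
      have "K * V m x = 0" if "N \<le> m" for m
      proof -
        have "1 / \<bar>g x\<bar> \<le> real m" using N that by (meson of_nat_mono order_trans)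
        then have "1 \<le> real m * \<bar>g x\<bar>" using \<open>g x \<noteq> 0\<close> by (simp add: pos_divide_le_eq)
        then show ?thesis by (simp add: V_def)
      qed
      then show "\<forall>\<^sub>F m in sequentially. K * V m x = 0" by (auto simp: eventually_sequentially)
    qed
    show "AE x in I01. norm (K * V m x) \<le> \<bar>K\<bar>" for m
      using V01 by (auto simp: abs_mult mult_left_le)
  qed measurable
  then have "\<forall>\<^sub>F m in sequentially. (LINT x|I01. K * V m x) < r / 2"
    using \<open>0 < r\<close> by (intro order_tendstoD) auto
  then obtain m where m: "(LINT x|I01. K * V m x) < r / 2"
    by (auto simp: eventually_sequentially)
  have "(\<lambda>n. real m * (LINT x|I01. D n x * \<bar>g x\<bar>)) \<longlonglongrightarrow> 0"
    using tendsto_mult_right_zero[OF lim] .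
  then have "\<forall>\<^sub>F n in sequentially. real m * (LINT x|I01. D n x * \<bar>g x\<bar>) < r / 2"
    using \<open>0 < r\<close> by (intro order_tendstoD) auto
  then obtain N where N: "\<And>n. N \<le> n \<Longrightarrow> real m * (LINT x|I01. D n x * \<bar>g x\<bar>) < r / 2"
    by (auto simp: eventually_sequentially)
  have "dist (LINT x|I01. D n x) 0 < r" if "N \<le> n" for n
  proof -
    have "0 \<le> (LINT x|I01. D n x)"
      by (rule integral_nonneg_AE) (use D(2)[of n] in auto)
    moreover have "(LINT x|I01. D n x) \<le> (LINT x|I01. real m * (D n x * \<bar>g x\<bar>) + K * V m x)"
    proof (rule integral_mono_AE)
      show "AE x in I01. D n x \<le> real m * (D n x * \<bar>g x\<bar>) + K * V m x"
        using D(2)[of n]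
      proof eventually_elim
        case (elim x)
        have "D n x * (1 - real m * \<bar>g x\<bar>) \<le> D n x * V m x"
          using elim by (intro mult_left_mono) (auto simp: V_def)
        also have "\<dots> \<le> K * V m x" using elim V01 by (intro mult_right_mono) auto
        finally show ?case by (simp add: algebra_simps)
      qed
    qed (use iD iDg iV in auto)
    moreover have "\<dots> = real m * (LINT x|I01. D n x * \<bar>g x\<bar>) + (LINT x|I01. K * V m x)"
      using iDg iV by simp
    ultimately show ?thesis using N[OF that] m by simp
  qed
  then show "\<exists>N. \<forall>n\<ge>N. dist (LINT x|I01. D n x) 0 < r" by blast
qed

lemma bounded_in_Lp:
  assumes g: "g \<in> borel_measurable I01" "AE x in I01. \<bar>g x\<bar> \<le> C" and "0 \<le> p"
  shows "g \<in> Lp p"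
proof -
  have "integrable I01 (\<lambda>x. \<bar>g x\<bar> powr p)"
  proof (rule Bochner_Integration.integrable_bound)
    show "integrable I01 (\<lambda>x. C powr p)" by (intro integrable_I01_continuous) simp
    show "AE x in I01. norm (\<bar>g x\<bar> powr p) \<le> norm (C powr p)"
      using g(2) by eventually_elim (simp add: powr_mono2 \<open>0 \<le> p\<close>)
  qed (use g in measurable)
  then show ?thesis using g by (simp add: Lp_def)
qed

text \<open>
  Interpolation with the uniform bound: \<open>\<bar>y\<bar> powr p \<le> K powr (p - 1) * \<bar>y\<bar>\<close> when \<open>\<bar>y\<bar> \<le> K\<close>.
\<close>

lemma bounded_L1_imp_Lp_convergence:
  fixes h :: "nat \<Rightarrow> real \<Rightarrow> real"
  assumes h: "\<And>n. h n \<in> borel_measurable I01" "\<And>n. AE x in I01. \<bar>h n x\<bar> \<le> K"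
    and lim: "(\<lambda>n. LINT x|I01. \<bar>h n x\<bar>) \<longlonglongrightarrow> 0" and "1 \<le> p"
  shows "(\<lambda>n. Lp_norm p (h n)) \<longlonglongrightarrow> 0"
proof -
  have nonneg: "0 \<le> (LINT x|I01. \<bar>h n x\<bar> powr p)" for n by (rule integral_nonneg_AE) simp
  have "(\<lambda>n. LINT x|I01. \<bar>h n x\<bar> powr p) \<longlonglongrightarrow> 0"
  proof (rule Lim_null_comparison)
    have "(LINT x|I01. \<bar>h n x\<bar> powr p) \<le> (LINT x|I01. K powr (p - 1) * \<bar>h n x\<bar>)" for n
    proof (rule integral_mono_AE)
      show "integrable I01 (\<lambda>x. \<bar>h n x\<bar> powr p)"
        using bounded_in_Lp[OF h, of p] \<open>1 \<le> p\<close> by (simp add: Lp_def)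
      show "integrable I01 (\<lambda>x. K powr (p - 1) * \<bar>h n x\<bar>)"
        using bounded_in_Lp[OF h, of 1] by (simp add: Lp_1_iff)
      show "AE x in I01. \<bar>h n x\<bar> powr p \<le> K powr (p - 1) * \<bar>h n x\<bar>"
        using h(2)[of n]
      proof eventually_elim
        case (elim x)
        have "\<bar>h n x\<bar> powr p = \<bar>h n x\<bar> powr (p - 1) * \<bar>h n x\<bar>"
          using powr_add[of "\<bar>h n x\<bar>" "p - 1" 1] by simp
        also have "\<dots> \<le> K powr (p - 1) * \<bar>h n x\<bar>"
          using elim \<open>1 \<le> p\<close> by (intro mult_right_mono powr_mono2) auto
        finally show ?case .
      qed
    qed
    then show "\<forall>\<^sub>F n in sequentially. norm (LINT x|I01. \<bar>h n x\<bar> powr p) \<le> K powr (p - 1) * (LINT x|I01. \<bar>h n x\<bar>)"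
      using nonneg by simp
    show "(\<lambda>n. K powr (p - 1) * (LINT x|I01. \<bar>h n x\<bar>)) \<longlonglongrightarrow> 0"
      by (rule tendsto_mult_right_zero[OF lim])
  qed
  then show ?thesis
    unfolding Lp_norm_def
    by (rule tendsto_zero_powrI[OF _ tendsto_const]) (use nonneg \<open>1 \<le> p\<close> in auto)
qed

section \<open>Stability and uniqueness of the coefficient\<close>

text \<open>
  Subtracting the two flux identities gives
  \<open>(b n - a) * u' = (c n - c0) - b n * (w n' - u')\<close>. The last term tends to \<open>0\<close> in \<open>L\<^sub>1\<close>, and the
  constants converge, so the left-hand side tends to \<open>0\<close> in \<open>L\<^sub>1\<close>; its weight \<open>u'\<close> vanishes only where
  the primitive of \<open>f\<close> equals \<open>c0\<close>, which is a null set because \<open>f\<close> is almost everywhere nonzero.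
\<close>

theorem coefficient_stability:
  fixes l L :: real
  assumes "0 < l"
    and f: "integrable I01 f" "AE x in I01. f x \<noteq> 0"
    and a: "a \<in> admissible l L" and b: "\<And>n. b n \<in> admissible l L"
    and u: "weak_solution f a u" and w: "\<And>n. weak_solution f (b n) (w n)"
    and conv: "(\<lambda>n. H1_norm (\<lambda>x. w n x - u x)) \<longlonglongrightarrow> 0"
  shows "(\<lambda>n. LINT x|I01. \<bar>b n x - a x\<bar>) \<longlonglongrightarrow> 0"
proof -
  let ?F = "primitive f" and ?g = "weak_deriv u" and ?h = "\<lambda>n. weak_deriv (w n)"
  have F: "continuous_on {0..1} ?F" by (rule continuous_on_primitive[OF f(1)])
  have bdd: "AE x in I01. \<bar>v x\<bar> \<le> L" if "v \<in> admissible l L" for v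
    using admissibleD(2,3)[OF that] by eventually_elim (use \<open>0 < l\<close> in auto)
  have H10: "u \<in> H10" "w n \<in> H10" for n using u w by (auto simp: weak_solution_def)
  note ig = weak_deriv_integrable(2)[OF H10_weak_deriv[OF H10(1)]]
    and ih = weak_deriv_integrable(2)[OF H10_weak_deriv[OF H10(2)]]
  note [measurable] = admissibleD(1)[OF a] admissibleD(1)[OF b]
    borel_measurable_integrable[OF ig] borel_measurable_integrable[OF ih]
  obtain c0 where c0: "AE x in I01. a x * ?g x = c0 - ?F x"
    using weak_solution_flux[OF f(1) admissibleD(1)[OF a] bdd[OF a] u] .
  have "\<exists>c. AE x in I01. b n x * ?h n x = c - ?F x" for n
    using weak_solution_flux[OF f(1) admissibleD(1)[OF b] bdd[OF b] w] by metis
  then obtain c where c: "\<And>n. AE x in I01. b n x * ?h n x = c n - ?F x" by metis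
  obtain x0 where x0: "0 \<le> x0" "x0 \<le> 1" "?F x0 = c0"
  proof (rule flux_vanishes_somewhere[OF ig H10_weak_deriv_mean_zero[OF H10(1)] _ c0 F])
    show "AE x in I01. 0 < a x"
      using admissibleD(2)[OF a] by eventually_elim (use \<open>0 < l\<close> in auto)
  qed
  \<comment> \<open>Membership of \<open>a\<close> forces this, as the interval is not a null set.\<close>
  have "l \<le> L"
  proof (rule ccontr)
    assume "\<not> ?thesis"
    with admissibleD(2,3)[OF a] have "AE x in I01. False" by (auto elim: eventually_elim2)
    then show False using AE_I01_not_False by blast
  qed
  define e where "e = (\<lambda>n x. L * \<bar>?h n x - ?g x\<bar>)"
  have ie: "integrable I01 (e n)" for n using ig ih[of n] by (simp add: e_def)
  have e0: "0 \<le> e n x" for n x using \<open>0 < l\<close> \<open>l \<le> L\<close> by (simp add: e_def)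
  have lime: "(\<lambda>n. LINT x|I01. e n x) \<longlonglongrightarrow> 0"
  proof (rule Lim_null_comparison)
    have "norm (LINT x|I01. e n x) \<le> L * H1_norm (\<lambda>x. w n x - u x)" for n
    proof -
      have "0 \<le> (LINT x|I01. e n x)" by (rule integral_nonneg_AE) (simp add: e0)
      moreover have "(LINT x|I01. \<bar>?h n x - ?g x\<bar>) \<le> H1_norm (\<lambda>x. w n x - u x)"
        by (intro H1_norm_ge has_weak_deriv_diff H10_weak_deriv H10)
      ultimately show ?thesis using \<open>0 < l\<close> \<open>l \<le> L\<close> by (simp add: e_def)
    qed
    then show "\<forall>\<^sub>F n in sequentially. norm (LINT x|I01. e n x) \<le> L * H1_norm (\<lambda>x. w n x - u x)"
      by simp
    show "(\<lambda>n. L * H1_norm (\<lambda>x. w n x - u x)) \<longlonglongrightarrow> 0"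
      by (rule tendsto_mult_right_zero[OF conv])
  qed
  have diff: "AE x in I01. \<bar>b n x - a x\<bar> \<le> L - l" for n
    using admissibleD(2,3)[OF a] admissibleD(2,3)[OF b[of n]] by eventually_elim auto
  have key: "AE x in I01. (b n x - a x) * ?g x = (c n - c0) - b n x * (?h n x - ?g x)" for n
    using c0 c[of n] by eventually_elim (simp add: algebra_simps)
  have err: "AE x in I01. \<bar>b n x * (?h n x - ?g x)\<bar> \<le> e n x" for n
    using bdd[OF b[of n]] by eventually_elim (auto simp: e_def abs_mult intro: mult_right_mono)
  have "c \<longlonglongrightarrow> c0"
  proof (rule constants_converge[OF F x0 _ ie e0 lime])
    show "0 \<le> (L - l) / l" using \<open>0 < l\<close> \<open>l \<le> L\<close> by simp
    show "AE x in I01. \<bar>c n - c0\<bar> \<le> (L - l) / l * \<bar>?F x - c0\<bar> + e n x" for n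
      using key[of n] err[of n] diff[of n] c0 admissibleD(2)[OF a]
    proof eventually_elim
      case (elim x)
      have "l * \<bar>?g x\<bar> \<le> a x * \<bar>?g x\<bar>" using elim by (intro mult_right_mono) auto
      also have "\<dots> = \<bar>?F x - c0\<bar>"
        using elim \<open>0 < l\<close> by (metis abs_minus_commute abs_mult abs_of_pos less_le_trans)
      finally have "\<bar>?g x\<bar> \<le> \<bar>?F x - c0\<bar> / l" using \<open>0 < l\<close> by (simp add: pos_le_divide_eq mult.commute)
      then have "\<bar>b n x - a x\<bar> * \<bar>?g x\<bar> \<le> (L - l) * (\<bar>?F x - c0\<bar> / l)"
        using elim by (intro mult_mono) auto
      then have "\<bar>(b n x - a x) * ?g x\<bar> \<le> (L - l) / l * \<bar>?F x - c0\<bar>" by (simp add: abs_mult)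
      then show ?case using elim by linarith
    qed
  qed
  have lim: "(\<lambda>n. LINT x|I01. \<bar>b n x - a x\<bar> * \<bar>?g x\<bar>) \<longlonglongrightarrow> 0"
  proof (rule Lim_null_comparison)
    have "norm (LINT x|I01. \<bar>b n x - a x\<bar> * \<bar>?g x\<bar>) \<le> \<bar>c n - c0\<bar> + (LINT x|I01. e n x)" for n
    proof -
      have "(LINT x|I01. \<bar>b n x - a x\<bar> * \<bar>?g x\<bar>) \<le> (LINT x|I01. \<bar>c n - c0\<bar> + e n x)"
      proof (rule integral_mono_AE)
        show "integrable I01 (\<lambda>x. \<bar>b n x - a x\<bar> * \<bar>?g x\<bar>)"
          using integrable_mult_bounded[OF integrable_abs[OF ig], of "\<lambda>x. \<bar>b n x - a x\<bar>" "L - l"] diff[of n]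
          by (simp add: mult.commute)
        show "integrable I01 (\<lambda>x. \<bar>c n - c0\<bar> + e n x)"
          using ie integrable_I01_continuous[of "\<lambda>x. \<bar>c n - c0\<bar>"] by simp
        show "AE x in I01. \<bar>b n x - a x\<bar> * \<bar>?g x\<bar> \<le> \<bar>c n - c0\<bar> + e n x"
          using key[of n] err[of n] by eventually_elim (simp flip: abs_mult)
      qed
      also have "\<dots> = \<bar>c n - c0\<bar> + (LINT x|I01. e n x)"
        using ie integrable_I01_continuous[of "\<lambda>x. \<bar>c n - c0\<bar>"] I01_const[of "\<bar>c n - c0\<bar>"]
        by (simp only: Bochner_Integration.integral_add continuous_on_const)
      finally show ?thesis by simp
    qed
    then show "\<forall>\<^sub>F n in sequentially. norm (LINT x|I01. \<bar>b n x - a x\<bar> * \<bar>?g x\<bar>) \<le> \<bar>c n - c0\<bar> + (LINT x|I01. e n x)"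
      by simp
    show "(\<lambda>n. \<bar>c n - c0\<bar> + (LINT x|I01. e n x)) \<longlonglongrightarrow> 0"
      using tendsto_add[OF tendsto_rabs_zero[OF LIM_zero[OF \<open>c \<longlonglongrightarrow> c0\<close>]] lime] by simp
  qed
  have ne: "AE x in I01. ?g x \<noteq> 0"
    using zero_on_level_set_of_primitive[OF f(1), of c0] c0 f(2) by eventually_elim auto
  show ?thesis
  proof (rule weighted_L1_convergence[OF _ _ ig ne lim])
    show "(\<lambda>x. \<bar>b n x - a x\<bar>) \<in> borel_measurable I01" for n by measurable
    show "AE x in I01. 0 \<le> \<bar>b n x - a x\<bar> \<and> \<bar>b n x - a x\<bar> \<le> L - l" for n
      using diff[of n] by simp
  qed
qed

text \<open>
  Uniqueness is stability applied to constant sequences: two coefficients with the same solution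
  differ by a sequence of constant norm that tends to \<open>0\<close>.
\<close>

theorem theorem12:
  fixes l L :: real and f :: "real \<Rightarrow> real"
  assumes "0 < l" and "l < L"
    and "f \<in> Lp 1" and "AE x in I01. f x \<noteq> 0"
  shows "(\<forall>a\<in>admissible l L. \<forall>a_seq u u_seq.
            (\<forall>n. a_seq n \<in> admissible l L) \<and>
            weak_solution f a u \<and> (\<forall>n. weak_solution f (a_seq n) (u_seq n)) \<and>
            tendsto_H10 u_seq u \<longrightarrow>
            (\<forall>p\<ge>1. tendsto_Lp p a_seq a)) \<and>
         (\<forall>a\<in>admissible l L. \<forall>b\<in>admissible l L. \<forall>u w.
            weak_solution f a u \<and> weak_solution f b w \<and> (AE x in I01. u x = w x) \<longrightarrow>
            (AE x in I01. a x = b x))"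
proof (intro conjI ballI allI impI; (elim conjE)?)
  have f: "integrable I01 f" using assms(3) by (simp add: Lp_1_iff)
  have bdd: "AE x in I01. \<bar>v x\<bar> \<le> L" if "v \<in> admissible l L" for v
    using admissibleD(2,3)[OF that] by eventually_elim (use \<open>0 < l\<close> in auto)
  {
    fix a a_seq u u_seq and p :: real
    assume a: "a \<in> admissible l L" "\<forall>n. a_seq n \<in> admissible l L"
      and u: "weak_solution f a u" "\<forall>n. weak_solution f (a_seq n) (u_seq n)" "tendsto_H10 u_seq u"
      and p: "1 \<le> p"
    have L1: "(\<lambda>n. LINT x|I01. \<bar>a_seq n x - a x\<bar>) \<longlonglongrightarrow> 0"
      by (rule coefficient_stability[OF \<open>0 < l\<close> f assms(4) a(1)]) (use a u in \<open>auto simp: tendsto_H10_def\<close>)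
    have "(\<lambda>n. Lp_norm p (\<lambda>x. a_seq n x - a x)) \<longlonglongrightarrow> 0"
    proof (rule bounded_L1_imp_Lp_convergence[OF _ _ L1 p])
      show "(\<lambda>x. a_seq n x - a x) \<in> borel_measurable I01" for n
        using admissibleD(1) a by (intro borel_measurable_diff) auto
      show "AE x in I01. \<bar>a_seq n x - a x\<bar> \<le> 2 * L" for n
        using bdd[OF a(1)] bdd[OF a(2)[rule_format, of n]] by eventually_elim auto
    qed
    moreover have "v \<in> Lp p" if "v \<in> admissible l L" for v
      using bounded_in_Lp[OF admissibleD(1)[OF that] bdd[OF that]] p by simp
    ultimately show "tendsto_Lp p a_seq a" using a by (simp add: tendsto_Lp_def)
  }
  {
    fix a b u w
    assume a: "a \<in> admissible l L" and b: "b \<in> admissible l L"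
      and u: "weak_solution f a u" and w: "weak_solution f b w" and uw: "AE x in I01. u x = w x"
    have "integrable I01 u" "integrable I01 w"
      using u w weak_deriv_integrable(1)[OF H10_weak_deriv] by (auto simp: weak_solution_def)
    then have "H1_norm (\<lambda>x. w x - u x) = 0"
      by (intro H1_norm_AE_zero borel_measurable_diff) (use uw in auto)
    then have "(\<lambda>n::nat. LINT x|I01. \<bar>b x - a x\<bar>) \<longlonglongrightarrow> 0"
      by (intro coefficient_stability[OF \<open>0 < l\<close> f assms(4) a b u w]) simp
    then have "(LINT x|I01. \<bar>b x - a x\<bar>) = 0" using LIMSEQ_unique[OF tendsto_const] by blast
    moreover have "integrable I01 v" if "v \<in> admissible l L" for v
      using bounded_in_Lp[OF admissibleD(1)[OF that] bdd[OF that], of 1] by (simp add: Lp_1_iff)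
    then have "integrable I01 (\<lambda>x. \<bar>b x - a x\<bar>)" using a b by simp
    ultimately have "AE x in I01. \<bar>b x - a x\<bar> = 0"
      using integral_nonneg_eq_0_iff_AE[of I01 "\<lambda>x. \<bar>b x - a x\<bar>"] by simp
    then show "AE x in I01. a x = b x" by eventually_elim simp
  }
qed

end
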